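(* Suppose that (A1) for all $b,b'\in\mathcal B$, $\phi(b,t)-\phi(b',t)$ is single-crossing in $t$ and $v(b,t)-v(b',t)$ is monotonic in $t$; and (A2) for all $a,a'\in\Delta(\mathcal B)$, $\phi(a,t)-\phi(a',t)$ is single-crossing in $t$. Suppose the consumer's valuation is additive, i.e. $v(b,t)=\sum_{i\in b}v(\{i\},t)$ for all $b\in\mathcal B$ and $t\in T$. If the ratios $\frac{\phi(b,\bar t)}{\phi(b,\underline t)}$ over singleton bundles $|b|=1$ are strictly ordered, i.e. $$\frac{\phi(b_{j_1},\bar t)}{\phi(b_{j_1},\underline t)}<\frac{\phi(b_{j_2},\bar t)}{\phi(b_{j_2},\underline t)}<\dots<\frac{\phi(b_{j_n},\bar t)}{\phi(b_{j_n},\underline t)},$$ where $\{b_{j_1},\dots,b_{j_n}\}=\{\{1\},\dots,\{n\}\}$, then the minimal optimal menu of the monopolist's problem is a nested menu; in particular, it is $$\Big\{\emptyset,\ b_{j_1},\ b_{j_1}\cup b_{j_2},\ \dots,\ \bigcup_{i=1}^{n-1}b_{j_i},\ b^*\Big\},$$ where $b^*=\{1,\dots,n\}$.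
   Context: Setup. There are $n\ge 1$ goods; $\mathcal B=2^{\{1,\dots,n\}}$ is the set of (deterministic) bundles and $\Delta(\mathcal B)$ is the set of probability distributions on $\mathcal B$ (stochastic bundles); a bundle $b$ is identified with the point mass at $b$. Types $t$ lie in $T=[\underline t,\bar t]\subseteq\mathbb R$, $\underline t<\bar t$, and are distributed according to $F$ with a continuous, positive density $f$. The value function $v:\Delta(\mathcal B)\times T\to\mathbb R$ is continuously differentiable in $t$, with $v(\emptyset,t)=0$ for all $t$ and $v(a,t)=\mathbb E_{b\sim a}[v(b,t)]$. The virtual value function is $\phi(b,t)=v(b,t)-\frac{1-F(t)}{f(t)}v_t(b,t)$, $v_t=\partial v/\partial t$, extended by $\phi(a,t)=\mathbb E_{b\sim a}[\phi(b,t)]$ for $a\in\Delta(\mathcal B)$; note $\phi(b,\bar t)=v(b,\bar t)$. Standing assumptions: for $b\ne b'$ in $\mathcal B$ there is $t\in T$ with $\phi(b,t)\neq\phi(b',t)$; $\max_{b\neq\emptyset}\phi(b,\underline t)<0=\phi(\emptyset,\underline t)$; and $v(b,\bar t)>0$ for all $b\ne\emptyset$. Terminology. A function $g:T\to\mathbb R$ is single-crossing in $t$ if $\operatorname{sign}[g(t)]\in\{-1,0,1\}$ is a monotonic function of $t$ (either weakly increasing or weakly decreasing). "Monotonic" means weakly increasing or weakly decreasing on $T$. Monopolist's problem. A mechanism is a measurable map $(a,p):T\to\Delta(\mathcal B)\times\mathbb R$. It is IC if $v(a(t),t)-p(t)\ge v(a(t'),t)-p(t')$ for all $t,t'\in T$,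 and IR if $v(a(t),t)-p(t)\ge 0$ for all $t\in T$. The monopolist maximizes $\mathbb E[p(t)]$ over IC and IR mechanisms. A menu $B\subseteq\mathcal B$ is optimal if there is an optimal mechanism $(a,p)$ with $a(t)\in B$ for all $t$; an optimal menu $B$ is a minimal optimal menu if no $B'\subsetneq B$ is optimal. (Under (A1) and (A2) the minimal optimal menu is unique.) A menu is nested if any two of its bundles are ordered by set inclusion. *)

theory Defs
  imports "HOL-Probability.Probability"
begin

definition bundles :: "nat \<Rightarrow> nat set set" where
  "bundles n = Pow {1..n}"

definition stochastic_bundles :: "nat \<Rightarrow> nat set pmf set" where
  "stochastic_bundles n = {a. set_pmf a \<subseteq> bundles n}"

text \<open>
  A function of deterministic bundles and types, such as the value function or the virtual
  value function, is extended to stochastic bundles by taking expectations. A deterministic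
  bundle \<open>b\<close> corresponds to the point mass \<open>return_pmf b\<close>.
\<close>

definition stoch_ext :: "(nat set \<Rightarrow> real \<Rightarrow> real) \<Rightarrow> nat set pmf \<Rightarrow> real \<Rightarrow> real" where
  "stoch_ext g a t = measure_pmf.expectation a (\<lambda>b. g b t)"

definition type_dist :: "real \<Rightarrow> real \<Rightarrow> (real \<Rightarrow> real) \<Rightarrow> real measure" where
  "type_dist t0 t1 f = density lborel (\<lambda>t. ennreal (indicator {t0..t1} t * f t))"

text \<open>The derivative is taken within the type interval, hence one-sided at its endpoints.\<close>

definition value_deriv ::
  "real \<Rightarrow> real \<Rightarrow> (nat set \<Rightarrow> real \<Rightarrow> real) \<Rightarrow> nat set \<Rightarrow> real \<Rightarrow> real" where
  "value_deriv t0 t1 v b t = vector_derivative (v b) (at t within {t0..t1})"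

definition virtual_value ::
  "real \<Rightarrow> real \<Rightarrow> (real \<Rightarrow> real) \<Rightarrow> (nat set \<Rightarrow> real \<Rightarrow> real) \<Rightarrow> nat set \<Rightarrow> real \<Rightarrow> real" where
  "virtual_value t0 t1 f v b t =
     v b t - (1 - cdf (type_dist t0 t1 f) t) / f t * value_deriv t0 t1 v b t"

definition monotonic_on :: "real set \<Rightarrow> (real \<Rightarrow> real) \<Rightarrow> bool" where
  "monotonic_on T g \<longleftrightarrow> mono_on T g \<or> antimono_on T g"

definition single_crossing_on :: "real set \<Rightarrow> (real \<Rightarrow> real) \<Rightarrow> bool" where
  "single_crossing_on T g \<longleftrightarrow> monotonic_on T (\<lambda>t. sgn (g t))"

text \<open>
  The primitives of the model: goods \<open>1, \<dots>, n\<close>, types in \<open>[t0, t1]\<close> with density \<open>f\<close>, and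
  the values \<open>v\<close> of the deterministic bundles. Functions of the type are constrained only
  on \<open>[t0, t1]\<close>.
\<close>

locale screening =
  fixes n :: nat and t0 t1 :: real and f :: "real \<Rightarrow> real"
    and v :: "nat set \<Rightarrow> real \<Rightarrow> real"
  assumes goods: "n \<ge> 1"
    and types: "t0 < t1"
    and density_continuous: "continuous_on {t0..t1} f"
    and density_pos: "\<forall>t\<in>{t0..t1}. f t > 0"
    and prob: "prob_space (type_dist t0 t1 f)"
    and value_differentiable: "\<forall>b\<in>bundles n. v b differentiable_on {t0..t1}"
    and value_deriv_continuous: "\<forall>b\<in>bundles n. continuous_on {t0..t1} (value_deriv t0 t1 v b)"
    and value_empty: "\<forall>t\<in>{t0..t1}. v {} t = 0"
    and virtual_value_distinct: "\<forall>b\<in>bundles n. \<forall>b'\<in>bundles n. b \<noteq> b' \<longrightarrow>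
      (\<exists>t\<in>{t0..t1}. virtual_value t0 t1 f v b t \<noteq> virtual_value t0 t1 f v b' t)"
    and virtual_value_lowest: "\<forall>b\<in>bundles n. b \<noteq> {} \<longrightarrow> virtual_value t0 t1 f v b t0 < 0"
    and value_highest: "\<forall>b\<in>bundles n. b \<noteq> {} \<longrightarrow> v b t1 > 0"

text \<open>
  The set of stochastic bundles is a simplex in a finite-dimensional space, so measurability
  of an allocation rule is measurability of each coordinate.
\<close>

definition mechanism ::
  "nat \<Rightarrow> real \<Rightarrow> real \<Rightarrow> (real \<Rightarrow> nat set pmf) \<Rightarrow> (real \<Rightarrow> real) \<Rightarrow> bool" where
  "mechanism n t0 t1 a p \<longleftrightarrow>
     (\<forall>t\<in>{t0..t1}. a t \<in> stochastic_bundles n) \<and>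
     (\<forall>b\<in>bundles n. (\<lambda>t. pmf (a t) b) \<in> borel_measurable (restrict_space borel {t0..t1})) \<and>
     p \<in> borel_measurable (restrict_space borel {t0..t1})"

definition incentive_compatible ::
  "real \<Rightarrow> real \<Rightarrow> (nat set \<Rightarrow> real \<Rightarrow> real) \<Rightarrow> (real \<Rightarrow> nat set pmf) \<Rightarrow> (real \<Rightarrow> real) \<Rightarrow> bool" where
  "incentive_compatible t0 t1 v a p \<longleftrightarrow>
     (\<forall>t\<in>{t0..t1}. \<forall>t'\<in>{t0..t1}.
        stoch_ext v (a t) t - p t \<ge> stoch_ext v (a t') t - p t')"

definition individually_rational ::
  "real \<Rightarrow> real \<Rightarrow> (nat set \<Rightarrow> real \<Rightarrow> real) \<Rightarrow> (real \<Rightarrow> nat set pmf) \<Rightarrow> (real \<Rightarrow> real) \<Rightarrow> bool" where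
  "individually_rational t0 t1 v a p \<longleftrightarrow>
     (\<forall>t\<in>{t0..t1}. stoch_ext v (a t) t - p t \<ge> 0)"

definition feasible_mechanism ::
  "nat \<Rightarrow> real \<Rightarrow> real \<Rightarrow> (nat set \<Rightarrow> real \<Rightarrow> real) \<Rightarrow>
   (real \<Rightarrow> nat set pmf) \<Rightarrow> (real \<Rightarrow> real) \<Rightarrow> bool" where
  "feasible_mechanism n t0 t1 v a p \<longleftrightarrow>
     mechanism n t0 t1 a p \<and> incentive_compatible t0 t1 v a p \<and> individually_rational t0 t1 v a p"

text \<open>
  The payment rule of a feasible mechanism is measurable and bounded on \<open>[t0, t1]\<close>, so the
  Bochner integral below is its genuine expectation. The integral is restricted to \<open>[t0, t1]\<close>
  because payment rules are unconstrained elsewhere.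
\<close>

definition revenue :: "real \<Rightarrow> real \<Rightarrow> (real \<Rightarrow> real) \<Rightarrow> (real \<Rightarrow> real) \<Rightarrow> real" where
  "revenue t0 t1 f p = (LINT t:{t0..t1}|type_dist t0 t1 f. p t)"

definition optimal_mechanism ::
  "nat \<Rightarrow> real \<Rightarrow> real \<Rightarrow> (real \<Rightarrow> real) \<Rightarrow> (nat set \<Rightarrow> real \<Rightarrow> real) \<Rightarrow>
   (real \<Rightarrow> nat set pmf) \<Rightarrow> (real \<Rightarrow> real) \<Rightarrow> bool" where
  "optimal_mechanism n t0 t1 f v a p \<longleftrightarrow>
     feasible_mechanism n t0 t1 v a p \<and>
     (\<forall>a' p'. feasible_mechanism n t0 t1 v a' p' \<longrightarrow> revenue t0 t1 f p' \<le> revenue t0 t1 f p)"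

definition optimal_menu ::
  "nat \<Rightarrow> real \<Rightarrow> real \<Rightarrow> (real \<Rightarrow> real) \<Rightarrow> (nat set \<Rightarrow> real \<Rightarrow> real) \<Rightarrow> nat set set \<Rightarrow> bool" where
  "optimal_menu n t0 t1 f v B \<longleftrightarrow>
     B \<subseteq> bundles n \<and>
     (\<exists>a p. optimal_mechanism n t0 t1 f v a p \<and> (\<forall>t\<in>{t0..t1}. a t \<in> return_pmf ` B))"

definition minimal_optimal_menu ::
  "nat \<Rightarrow> real \<Rightarrow> real \<Rightarrow> (real \<Rightarrow> real) \<Rightarrow> (nat set \<Rightarrow> real \<Rightarrow> real) \<Rightarrow> nat set set \<Rightarrow> bool" where
  "minimal_optimal_menu n t0 t1 f v B \<longleftrightarrow>
     optimal_menu n t0 t1 f v B \<and> (\<forall>B'. B' \<subset> B \<longrightarrow> \<not> optimal_menu n t0 t1 f v B')"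

definition nested_menu :: "nat set set \<Rightarrow> bool" where
  "nested_menu B \<longleftrightarrow> chain_subset B"

end

theory Submission
  imports Defs
begin

text \<open>
  The revenue of a feasible mechanism is at most its expected virtual value. The envelope
  inequality behind this needs no differentiability of the indirect utility \<open>U\<close>: incentive
  compatibility bounds \<open>U (t + e) - U t\<close> below by the increment of the value of the bundle chosen
  at \<open>t\<close>; divide by \<open>e\<close>, integrate against \<open>1 - F\<close>, and let \<open>e\<close> tend to 0.

  For additive values the virtual value is maximised pointwise by selling the goods whose virtual
  value is positive. Each such good stays positive above a threshold type, so posting for every
  good its value at the threshold is feasible and attains the bound.

  Normalise the virtual values to \<open>u\<^sub>k = \<phi>(b\<^sub>j\<^sub>k, t) / \<phi>(b\<^sub>j\<^sub>k, t0)\<close>. All of them are 1 at \<open>t0\<close>, they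
  are ordered by the ratios at \<open>t1\<close>, and (A2) makes their combinations single-crossing, so
  \<open>u\<^sub>i \<le> u\<^sub>k\<close> everywhere for \<open>i < k\<close>; hence the sold bundles are initial segments. Moreover
  \<open>u\<^sub>k < 0 < u\<^sub>k\<^sub>+\<^sub>1\<close> on a nonempty open set of types, where the segment of length \<open>k\<close> is the unique
  maximiser. An optimal mechanism maximises the virtual value almost everywhere, so every
  optimal menu contains every initial segment.
\<close>

subsection \<open>Difference quotients and integrals on an interval\<close>

text \<open>Truncation by \<open>min\<close> keeps the shifted argument inside the interval. It is
  inactive for large \<open>m\<close> because \<open>t < b\<close>, so the limit is the derivative
  within the interval.\<close>

lemma right_difference_quotient_LIMSEQ:
  fixes F :: "real \<Rightarrow> real"
  assumes F: "(F has_real_derivative D) (at t within {a..b})" and t: "a \<le> t" "t < b"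
  shows "(\<lambda>m. (F (min b (t + inverse (real (Suc m)))) - F t) * real (Suc m)) \<longlonglongrightarrow> D"
proof -
  have null: "(\<lambda>m. t + inverse (real (Suc m))) \<longlonglongrightarrow> t"
    using tendsto_add[OF tendsto_const LIMSEQ_inverse_real_of_nat, of t] by simp
  have less: "\<forall>\<^sub>F m in sequentially. t + inverse (real (Suc m)) < b"
    using order_tendstoD(2)[OF null t(2)] .
  have "filterlim (\<lambda>m. t + inverse (real (Suc m))) (at t within {a..b}) sequentially"
    unfolding filterlim_at
  proof
    show "\<forall>\<^sub>F m in sequentially. t + inverse (real (Suc m)) \<in> {a..b} \<and> t + inverse (real (Suc m)) \<noteq> t"
      using less by eventually_elim (use t in \<open>simp add: add_increasing2\<close>)
  qed (rule null)
  then have "(\<lambda>m. (F (t + inverse (real (Suc m))) - F t) / (t + inverse (real (Suc m)) - t)) \<longlonglongrightarrow> D"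
    using F unfolding has_field_derivative_iff by (rule filterlim_compose[rotated])
  moreover have "\<forall>\<^sub>F m in sequentially.
      (F (t + inverse (real (Suc m))) - F t) / (t + inverse (real (Suc m)) - t) =
      (F (min b (t + inverse (real (Suc m)))) - F t) * real (Suc m)"
    using less by eventually_elim (simp add: min_def divide_inverse)
  ultimately show ?thesis
    by (rule Lim_transform_eventually)
qed

lemma set_integrable_Icc_bounded:
  fixes g :: "real \<Rightarrow> real"
  assumes g: "g \<in> borel_measurable (restrict_space borel {a..b})"
    and bound: "\<And>t. t \<in> {a..b} \<Longrightarrow> \<bar>g t\<bar> \<le> B"
  shows "set_integrable lborel {a..b} g"
  using borel_integrable_atLeastAtMost'[of a b "\<lambda>_. B"]
proof (rule set_integrable_bound)
  show "set_borel_measurable lborel {a..b} g"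
    using g by (simp add: borel_measurable_restrict_space_iff set_borel_measurable_def)
  show "AE t in lborel. t \<in> {a..b} \<longrightarrow> norm (g t) \<le> norm B"
    using bound by (auto intro!: AE_I2 order_trans[OF _ abs_ge_self])
qed simp

text \<open>Dominated convergence with a constant majorant. Convergence is not asked for at
  \<open>b\<close>, a null set: truncated difference quotients are 0 there and need not tend to the
  derivative.\<close>

lemma set_integral_Icc_LIMSEQ_bounded:
  fixes s :: "nat \<Rightarrow> real \<Rightarrow> real"
  assumes "\<And>m. s m \<in> borel_measurable (restrict_space borel {a..b})"
    "g \<in> borel_measurable (restrict_space borel {a..b})"
    and lim: "\<And>t. a \<le> t \<Longrightarrow> t < b \<Longrightarrow> (\<lambda>m. s m t) \<longlonglongrightarrow> g t"
    and bound: "\<And>m t. t \<in> {a..b} \<Longrightarrow> \<bar>s m t\<bar> \<le> B"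
  shows "(\<lambda>m. LINT t:{a..b}|lborel. s m t) \<longlonglongrightarrow> (LINT t:{a..b}|lborel. g t)"
  unfolding set_lebesgue_integral_def
proof (rule integral_dominated_convergence[where w = "\<lambda>t. indicator {a..b} t *\<^sub>R B"])
  show "integrable lborel (\<lambda>t. indicat_real {a..b} t *\<^sub>R B)"
    using borel_integrable_atLeastAtMost'[of a b "\<lambda>_. B"] by (simp add: set_integrable_def)
  show "AE t in lborel. (\<lambda>m. indicat_real {a..b} t *\<^sub>R s m t) \<longlonglongrightarrow> indicat_real {a..b} t *\<^sub>R g t"
    using AE_lborel_singleton[of b]
  proof eventually_elim
    case (elim t)
    then show ?case using lim[of t] by (cases "t \<in> {a..b}") auto
  qed
  show "AE t in lborel. norm (indicat_real {a..b} t *\<^sub>R s m t) \<le> indicat_real {a..b} t *\<^sub>R B" for m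
    using bound by (auto simp: indicator_def)
qed (use assms(1,2) in \<open>simp_all add: borel_measurable_restrict_space_iff\<close>)

lemma set_integral_FTC_Icc:
  fixes F :: "real \<Rightarrow> real"
  assumes "a \<le> b" "\<And>x. x \<in> {a..b} \<Longrightarrow> (F has_real_derivative g x) (at x within {a..b})"
    "continuous_on {a..b} g"
  shows "(LINT x:{a..b}|lborel. g x) = F b - F a"
  using integral_FTC_Icc[of a b F g] assms
  by (simp add: set_lebesgue_integral_def has_real_derivative_iff_has_vector_derivative)

lemma continuous_on_Icc_abs_bound:
  fixes g :: "real \<Rightarrow> real"
  assumes "continuous_on {a..b} g"
  obtains B where "B \<ge> 0" "\<And>t. t \<in> {a..b} \<Longrightarrow> \<bar>g t\<bar> \<le> B"
proof -
  have "bounded (g ` {a..b})"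
    using assms by (intro compact_imp_bounded compact_continuous_image) auto
  then obtain B where "\<forall>x\<in>g ` {a..b}. norm x \<le> B"
    using bounded_iff by blast
  then show thesis
    by (intro that[of "\<bar>B\<bar>"]) force+
qed

text \<open>
  Integration by parts for a merely continuous \<open>U\<close>: the difference quotients of \<open>U\<close> are the
  derivatives of its moving averages, to which the fundamental theorem applies.
\<close>

lemma integral_difference_quotients_by_parts:
  fixes U G g :: "real \<Rightarrow> real"
  assumes ab: "a < b" and U: "continuous_on {a..b} U" and g: "continuous_on {a..b} g"
    and G: "\<And>t. t \<in> {a..b} \<Longrightarrow> (G has_real_derivative - g t) (at t within {a..b})"
    and Gb: "G b = 0"
  shows "(\<lambda>m. LINT t:{a..b}|lborel. (U (min b (t + inverse (real (Suc m)))) - U t) * real (Suc m) * G t)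
    \<longlonglongrightarrow> (LINT t:{a..b}|lborel. U t * g t) - U a * G a"
proof -
  let ?e = "\<lambda>m. inverse (real (Suc m))"
  \<comment> \<open>Constant continuation to the right of \<open>b\<close> gives the average over
    \<open>[t, t + ?e m]\<close> a meaning for all \<open>t \<le> b\<close>; the steps are at most
    1, so \<open>b + 1\<close> leaves enough room.\<close>
  define V where "V t = U (min b t)" for t
  have V: "continuous_on {a..b + 1} V"
    unfolding V_def using ab
    by (intro continuous_on_compose2[OF U] continuous_intros) auto
  have VU: "V t = U t" if "t \<in> {a..b}" for t
    using that by (simp add: V_def)
  obtain B where B: "B \<ge> 0" "\<And>t. t \<in> {a..b+1} \<Longrightarrow> \<bar>V t\<bar> \<le> B"
    using continuous_on_Icc_abs_bound[OF V] by blast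
  obtain C where C: "C \<ge> 0" "\<And>t. t \<in> {a..b} \<Longrightarrow> \<bar>g t\<bar> \<le> C"
    using continuous_on_Icc_abs_bound[OF g] by blast
  define P where "P t = integral {a..t} V" for t
  have P: "(P has_real_derivative V t) (at t within {a..b + 1})" if "t \<in> {a..b+1}" for t
    unfolding P_def by (rule integral_has_real_derivative[OF V that])
  have e: "0 < ?e m" "?e m \<le> 1" for m
    by (auto simp: field_simps)
  define Q where "Q m t = (P (t + ?e m) - P t) * real (Suc m)" for m t
  define q where "q m t = (V (t + ?e m) - V t) * real (Suc m)" for m t
  have Q: "(Q m has_real_derivative q m t) (at t within {a..b})" if "t \<in> {a..b}" for m t
  proof -
    have "(P has_real_derivative V t) (at t within {a..b})"
      by (rule DERIV_subset[OF P]) (use that in auto)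
    moreover have "((\<lambda>t. P (t + ?e m)) has_real_derivative V (t + ?e m)) (at t within {a..b})"
    proof -
      have "(P has_real_derivative V (t + ?e m)) (at (t + ?e m) within (\<lambda>t. t + ?e m) ` {a..b})"
        by (rule DERIV_subset[OF P]) (use that e(2)[of m] in \<open>auto simp: add_increasing2\<close>)
      moreover have "((\<lambda>t. t + ?e m) has_real_derivative 1) (at t within {a..b})"
        by (auto intro!: derivative_eq_intros)
      ultimately show ?thesis
        using DERIV_image_chain[of P "V (t + ?e m)" "\<lambda>t. t + ?e m" t "{a..b}" 1]
        by (simp add: o_def)
    qed
    ultimately show ?thesis
      unfolding Q_def q_def by (intro DERIV_cmult_right DERIV_diff)
  qed
  have contq: "continuous_on {a..b} (q m)" for m
    unfolding q_def using e[of m]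
    by (intro continuous_intros continuous_on_compose2[OF V]) auto
  have contQ: "continuous_on {a..b} (Q m)" for m
    using Q by (intro DERIV_continuous_on)
  have contG: "continuous_on {a..b} G"
    using G by (intro DERIV_continuous_on)
  have limQ: "(\<lambda>m. Q m t) \<longlonglongrightarrow> U t" if "t \<in> {a..b}" for t
  proof -
    have "min (b + 1) (t + ?e m) = t + ?e m" for m
      using that e[of m] by auto
    then show ?thesis
      using right_difference_quotient_LIMSEQ[OF P[of t]] that VU[of t] by (simp add: Q_def)
  qed
  have boundQ: "\<bar>Q m t\<bar> \<le> B" if "t \<in> {a..b}" for m t
  proof -
    have "norm (P (t + ?e m) - P t) \<le> B * norm (t + ?e m - t)"
      using that e[of m]
      by (intro field_differentiable_bound[where S = "{a..b+1}" and f' = V]) (auto simp: add_increasing2 intro!: P B)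
    then have "\<bar>P (t + ?e m) - P t\<bar> * real (Suc m) \<le> B * ?e m * real (Suc m)"
      using e[of m] by (intro mult_right_mono) auto
    moreover have "B * ?e m * real (Suc m) = B" by simp
    ultimately have "\<bar>P (t + ?e m) - P t\<bar> * real (Suc m) \<le> B" by (simp only:)
    then show ?thesis by (simp add: Q_def abs_mult)
  qed
  have parts: "(LINT t:{a..b}|lborel. q m t * G t) = (LINT t:{a..b}|lborel. Q m t * g t) - Q m a * G a" for m
  proof -
    \<comment> \<open>This is the product rule for \<open>Q m t * G t\<close>; the boundary term at
      \<open>b\<close> then drops out because \<open>G b = 0\<close>.\<close>
    have "(LINT t:{a..b}|lborel. q m t * G t - Q m t * g t) = Q m b * G b - Q m a * G a"
      by (rule set_integral_FTC_Icc)
        (use ab in \<open>auto intro!: derivative_eq_intros Q G continuous_intros contq contG contQ g\<close>)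
    moreover have "(LINT t:{a..b}|lborel. q m t * G t - Q m t * g t) =
        (LINT t:{a..b}|lborel. q m t * G t) - (LINT t:{a..b}|lborel. Q m t * g t)"
      by (intro set_integral_diff borel_integrable_atLeastAtMost' continuous_intros contq contG contQ g)
    ultimately show ?thesis using Gb by simp
  qed
  have "(\<lambda>m. LINT t:{a..b}|lborel. Q m t * g t) \<longlonglongrightarrow> (LINT t:{a..b}|lborel. U t * g t)"
  proof (rule set_integral_Icc_LIMSEQ_bounded[where B = "B * C"])
    show "\<bar>Q m t * g t\<bar> \<le> B * C" if "t \<in> {a..b}" for m t
      using boundQ[OF that, of m] C(2)[OF that] B C by (simp add: abs_mult mult_mono)
  qed (auto intro!: borel_measurable_continuous_on_restrict continuous_intros contQ g U tendsto_mult limQ)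
  moreover have "(\<lambda>m. Q m a * G a) \<longlonglongrightarrow> U a * G a"
    using limQ[of a] ab by (auto intro: tendsto_mult)
  ultimately have "(\<lambda>m. LINT t:{a..b}|lborel. q m t * G t)
      \<longlonglongrightarrow> (LINT t:{a..b}|lborel. U t * g t) - U a * G a"
    unfolding parts by (rule tendsto_diff)
  moreover have "(LINT t:{a..b}|lborel. q m t * G t) =
      (LINT t:{a..b}|lborel. (U (min b (t + ?e m)) - U t) * real (Suc m) * G t)" for m
    by (rule set_lebesgue_integral_cong) (auto simp: q_def V_def)
  ultimately show ?thesis by simp
qed

text \<open>Such a set contains a nondegenerate open interval, even if its known point is an
  endpoint of \<open>{a..b}\<close>, and so it is not contained in a null set.\<close>

lemma AE_lborel_openin_Icc_witness:
  fixes P :: "real \<Rightarrow> bool"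
  assumes AE: "AE t in lborel. t \<in> {a..b} \<longrightarrow> P t" and ab: "a < b"
    and O: "openin (top_of_set {a..b}) S" and t: "t \<in> S"
  obtains s where "s \<in> S" "P s"
proof (rule ccontr)
  assume none: "\<not> thesis"
  obtain e where e: "e > 0" "ball t e \<inter> {a..b} \<subseteq> S"
    using O t unfolding openin_contains_ball by blast
  have t': "t \<in> {a..b}" using O t openin_imp_subset by blast
  define c d where "c = max a (t - e)" and "d = min b (t + e)"
  have cd: "c < d" using e t' ab by (auto simp: c_def d_def)
  have sub: "{c<..<d} \<subseteq> S"
    using e by (auto simp: c_def d_def dist_real_def subset_eq)
  have "AE t in lborel. t \<notin> {c<..<d}"
    using AE
  proof eventually_elim
    case (elim s)
    then show ?case
      using sub none that O by (metis openin_imp_subset subsetD)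
  qed
  then have "emeasure lborel {c<..<d} = 0"
    by (subst (asm) AE_iff_measurable[of "{c<..<d}"]) auto
  then show False using cd by simp
qed

subsection \<open>The virtual surplus bound\<close>

lemma finite_bundles [simp]: "finite (bundles n)"
  by (simp add: bundles_def)

lemma sum_pmf_bundles:
  "a \<in> stochastic_bundles n \<Longrightarrow> (\<Sum>b\<in>bundles n. pmf a b) = 1"
  by (intro sum_pmf_eq_1) (auto simp: stochastic_bundles_def)

lemma stoch_ext_eq_sum:
  "a \<in> stochastic_bundles n \<Longrightarrow> stoch_ext g a t = (\<Sum>b\<in>bundles n. pmf a b * g b t)"
  unfolding stoch_ext_def
  by (subst integral_measure_pmf_real[of "bundles n"])
    (auto simp: stochastic_bundles_def mult.commute)

lemma stoch_ext_return_pmf [simp]: "stoch_ext g (return_pmf b) t = g b t"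
  by (simp add: stoch_ext_def)

lemma abs_stoch_ext_le:
  assumes a: "a \<in> stochastic_bundles n" and g: "\<And>b. b \<in> bundles n \<Longrightarrow> \<bar>g b t\<bar> \<le> B"
  shows "\<bar>stoch_ext g a t\<bar> \<le> B"
proof -
  have "\<bar>stoch_ext g a t\<bar> \<le> (\<Sum>b\<in>bundles n. \<bar>pmf a b * g b t\<bar>)"
    unfolding stoch_ext_eq_sum[OF a] by (rule sum_abs)
  also have "\<dots> \<le> (\<Sum>b\<in>bundles n. pmf a b * B)"
    by (intro sum_mono) (simp add: abs_mult mult_left_mono g)
  also have "\<dots> = B"
    by (simp add: sum_pmf_bundles[OF a] flip: sum_distrib_right)
  finally show ?thesis .
qed

lemma stoch_ext_measurable:
  assumes "mechanism n t0 t1 a p" "\<And>b. b \<in> bundles n \<Longrightarrow> continuous_on {t0..t1} (g b)"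
  shows "(\<lambda>t. stoch_ext g (a t) t) \<in> borel_measurable (restrict_space borel {t0..t1})"
proof -
  have "(\<lambda>t. \<Sum>b\<in>bundles n. pmf (a t) b * g b t) \<in> borel_measurable (restrict_space borel {t0..t1})"
    using assms(1)
    by (intro borel_measurable_sum borel_measurable_times
        borel_measurable_continuous_on_restrict[OF assms(2)]) (auto simp: mechanism_def)
  then show ?thesis
    by (subst measurable_cong[where g = "\<lambda>t. \<Sum>b\<in>bundles n. pmf (a t) b * g b t"])
      (use assms(1) in \<open>auto simp: mechanism_def stoch_ext_eq_sum space_restrict_space\<close>)
qed

lemma stoch_ext_uniform_bound:
  assumes "mechanism n t0 t1 a p" "\<And>b. b \<in> bundles n \<Longrightarrow> continuous_on {t0..t1} (g b)"
  obtains B where "B \<ge> 0" "\<And>t. t \<in> {t0..t1} \<Longrightarrow> \<bar>stoch_ext g (a t) t\<bar> \<le> B"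
proof -
  have cont: "continuous_on {t0..t1} (\<lambda>t. \<Sum>b\<in>bundles n. \<bar>g b t\<bar>)"
    by (intro continuous_intros assms)
  obtain B where B: "B \<ge> 0" "\<And>t. t \<in> {t0..t1} \<Longrightarrow> \<bar>\<Sum>b\<in>bundles n. \<bar>g b t\<bar>\<bar> \<le> B"
    using continuous_on_Icc_abs_bound[OF cont] by blast
  have le: "\<bar>stoch_ext g (a t) t\<bar> \<le> B" if t: "t \<in> {t0..t1}" for t
  proof (rule abs_stoch_ext_le)
    show "a t \<in> stochastic_bundles n" using assms(1) t by (simp add: mechanism_def)
    fix b assume "b \<in> bundles n"
    then have "\<bar>g b t\<bar> \<le> (\<Sum>b\<in>bundles n. \<bar>g b t\<bar>)"
      by (intro member_le_sum) auto
    then show "\<bar>g b t\<bar> \<le> B" using B(2)[OF t] by linarith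
  qed
  show thesis by (rule that[OF B(1) le])
qed

lemma set_integrable_stoch_ext:
  assumes mech: "mechanism n t0 t1 a p"
    and g: "\<And>b. b \<in> bundles n \<Longrightarrow> continuous_on {t0..t1} (g b)"
    and h: "continuous_on {t0..t1} h"
  shows "set_integrable lborel {t0..t1} (\<lambda>t. h t * stoch_ext g (a t) t)"
proof -
  obtain B where B: "B \<ge> 0" "\<And>t. t \<in> {t0..t1} \<Longrightarrow> \<bar>stoch_ext g (a t) t\<bar> \<le> B"
    using stoch_ext_uniform_bound[where g = g, OF mech g] by blast
  obtain C where C: "C \<ge> 0" "\<And>t. t \<in> {t0..t1} \<Longrightarrow> \<bar>h t\<bar> \<le> C"
    using continuous_on_Icc_abs_bound[OF h] by blast
  show ?thesis
  proof (rule set_integrable_Icc_bounded)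
    show "(\<lambda>t. h t * stoch_ext g (a t) t) \<in> borel_measurable (restrict_space borel {t0..t1})"
      by (intro borel_measurable_times stoch_ext_measurable[OF mech g]
          borel_measurable_continuous_on_restrict h)
    show "\<bar>h t * stoch_ext g (a t) t\<bar> \<le> C * B" if "t \<in> {t0..t1}" for t
      using B C that by (simp add: abs_mult mult_mono)
  qed
qed

section \<open>Survival function, virtual values and the envelope inequality\<close>

context screening
begin

abbreviation survival :: "real \<Rightarrow> real" where
  "survival t \<equiv> 1 - cdf (type_dist t0 t1 f) t"

abbreviation \<phi> :: "nat set \<Rightarrow> real \<Rightarrow> real" where
  "\<phi> \<equiv> virtual_value t0 t1 f v"

abbreviation v\<^sub>t :: "nat set \<Rightarrow> real \<Rightarrow> real" where
  "v\<^sub>t \<equiv> value_deriv t0 t1 v"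

lemma density_measurable: "(\<lambda>t. indicator {t0..t1} t * f t) \<in> borel_measurable borel"
  using borel_measurable_continuous_on_indicator[OF _ density_continuous] by simp

text \<open>The indicator in \<open>type_dist\<close> leaves no mass below \<open>t0\<close>. The
  integral form lets the fundamental theorem differentiate the distribution function.\<close>

lemma cdf_eq_integral:
  assumes t: "t \<in> {t0..t1}"
  shows "cdf (type_dist t0 t1 f) t = integral {t0..t} f"
proof -
  have cont: "continuous_on {t0..t} f"
    using density_continuous t by (auto intro: continuous_on_subset)
  have int: "set_integrable lborel {t0..t} f"
    by (rule borel_integrable_atLeastAtMost'[OF cont])
  have nonneg: "0 \<le> f s" if "s \<in> {t0..t}" for s
    using density_pos t that by (force intro: less_imp_le)
  have "emeasure (type_dist t0 t1 f) {..t} =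
      (\<integral>\<^sup>+s. ennreal (indicator {t0..t1} s * f s) * indicator {..t} s \<partial>lborel)"
    unfolding type_dist_def using density_measurable by (subst emeasure_density) auto
  also have "\<dots> = (\<integral>\<^sup>+s. ennreal (indicator {t0..t} s *\<^sub>R f s) \<partial>lborel)"
    by (rule nn_integral_cong) (use t in \<open>auto simp: indicator_def\<close>)
  also have "\<dots> = ennreal (LINT s:{t0..t}|lborel. f s)"
    unfolding set_lebesgue_integral_def
    by (rule nn_integral_eq_integral)
      (use int nonneg in \<open>auto simp: set_integrable_def indicator_def\<close>)
  finally have "measure (type_dist t0 t1 f) {..t} = (LINT s:{t0..t}|lborel. f s)"
    by (auto simp: measure_def set_lebesgue_integral_def indicator_def nonneg intro!: integral_nonneg_AE)
  then show ?thesis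
    by (simp add: cdf_def set_borel_integral_eq_integral[OF int])
qed

lemma survival_DERIV:
  assumes "t \<in> {t0..t1}"
  shows "(survival has_real_derivative - f t) (at t within {t0..t1})"
proof -
  have "((\<lambda>t. 1 - integral {t0..t} f) has_real_derivative - f t) (at t within {t0..t1})"
    using integral_has_real_derivative[OF density_continuous assms]
    by (auto intro!: derivative_eq_intros)
  then show ?thesis
    by (rule has_field_derivative_transform_within[OF _ zero_less_one assms])
      (simp add: cdf_eq_integral)
qed

lemma survival_lowest: "survival t0 = 1"
  using types by (simp add: cdf_eq_integral)

text \<open>All mass lies in \<open>{..t1}\<close> and the total mass is 1. This removes the
  boundary term at \<open>t1\<close> in the integrations by parts.\<close>

lemma survival_highest: "survival t1 = 0"
proof -
  interpret prob_space "type_dist t0 t1 f" by (rule prob)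
  have "AE s in type_dist t0 t1 f. s \<in> {..t1}"
    unfolding type_dist_def using density_measurable
    by (subst AE_density) (auto simp: indicator_def)
  moreover have "{..t1} \<in> events"
    by (simp add: type_dist_def)
  ultimately show ?thesis
    unfolding cdf_def using prob_eq_1 by auto
qed

lemma survival_nonneg: "survival t \<ge> 0"
  using prob_space.prob_le_1[OF prob, of "{..t}"] by (simp add: cdf_def)

lemma survival_continuous: "continuous_on {t0..t1} survival"
  by (rule DERIV_continuous_on[OF survival_DERIV])

lemma value_DERIV:
  assumes "b \<in> bundles n" "t \<in> {t0..t1}"
  shows "(v b has_real_derivative v\<^sub>t b t) (at t within {t0..t1})"
  using assms value_differentiable
  by (simp add: value_deriv_def has_real_derivative_iff_has_vector_derivative
      vector_derivative_works[symmetric] differentiable_on_def)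

lemma value_continuous: "b \<in> bundles n \<Longrightarrow> continuous_on {t0..t1} (v b)"
  using value_differentiable by (simp add: differentiable_imp_continuous_on)

lemma virtual_value_continuous: "b \<in> bundles n \<Longrightarrow> continuous_on {t0..t1} (\<phi> b)"
  unfolding virtual_value_def[abs_def] using density_pos value_deriv_continuous
  by (intro continuous_intros value_continuous survival_continuous density_continuous) force+

text \<open>Clearing the quotient leaves, for a bundle \<open>b\<close>, the derivative of
  \<open>- survival t * v b t\<close>; in this form virtual values enter the integrals.\<close>

lemma density_virtual_value:
  "t \<in> {t0..t1} \<Longrightarrow> f t * \<phi> b t = f t * v b t - survival t * v\<^sub>t b t"
  using density_pos by (force simp: virtual_value_def field_simps)

lemma value_lipschitz:
  obtains L where "L \<ge> 0" "\<And>b s t. b \<in> bundles n \<Longrightarrow> s \<in> {t0..t1} \<Longrightarrow> t \<in> {t0..t1} \<Longrightarrow>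
    \<bar>v b s - v b t\<bar> \<le> L * \<bar>s - t\<bar>"
proof -
  have cont: "continuous_on {t0..t1} (\<lambda>t. \<Sum>b\<in>bundles n. \<bar>v\<^sub>t b t\<bar>)"
    using value_deriv_continuous by (intro continuous_intros) auto
  obtain L where L: "L \<ge> 0" "\<And>t. t \<in> {t0..t1} \<Longrightarrow> \<bar>\<Sum>b\<in>bundles n. \<bar>v\<^sub>t b t\<bar>\<bar> \<le> L"
    using continuous_on_Icc_abs_bound[OF cont] by blast
  have "\<bar>v b s - v b t\<bar> \<le> L * \<bar>s - t\<bar>"
    if b: "b \<in> bundles n" and st: "s \<in> {t0..t1}" "t \<in> {t0..t1}" for b s t
  proof -
    have "norm (v\<^sub>t b r) \<le> L" if "r \<in> {t0..t1}" for r
    proof -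
      have "\<bar>v\<^sub>t b r\<bar> \<le> (\<Sum>b\<in>bundles n. \<bar>v\<^sub>t b r\<bar>)"
        using b by (intro member_le_sum) auto
      then show ?thesis using L(2)[OF that] by simp
    qed
    then show ?thesis
      using field_differentiable_bound[of "{t0..t1}" "v b" "v\<^sub>t b" L s t] value_DERIV[OF b] st
      by simp
  qed
  then show thesis using that L(1) by blast
qed

lemma revenue_eq_integral:
  assumes "p \<in> borel_measurable (restrict_space borel {t0..t1})"
  shows "revenue t0 t1 f p = (LINT t:{t0..t1}|lborel. f t * p t)"
proof -
  have "revenue t0 t1 f p =
      (LINT t|lborel. (indicator {t0..t1} t * f t) *\<^sub>R (indicator {t0..t1} t *\<^sub>R p t))"
    unfolding revenue_def set_lebesgue_integral_def type_dist_def
    using assms density_measurable density_pos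
    by (intro integral_density)
      (auto simp: borel_measurable_restrict_space_iff indicator_def less_imp_le)
  also have "\<dots> = (LINT t:{t0..t1}|lborel. f t * p t)"
    unfolding set_lebesgue_integral_def by (intro Bochner_Integration.integral_cong) (auto simp: indicator_def)
  finally show ?thesis .
qed

text \<open>A payment is value minus \<open>U\<close>, so revenue is the virtual surplus plus the
  integral of \<open>survival\<close> times the expected derivative of the value, minus the integral
  of \<open>U t * f t\<close>. The envelope inequality and \<open>U t0 \<ge> 0\<close> show that the
  second integral does not exceed the third.\<close>

lemma revenue_le_virtual_surplus:
  assumes feasible: "feasible_mechanism n t0 t1 v a p"
  shows "revenue t0 t1 f p \<le> (LINT t:{t0..t1}|lborel. f t * stoch_ext \<phi> (a t) t)"
proof -
  have mech: "mechanism n t0 t1 a p" and IC: "incentive_compatible t0 t1 v a p"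
    and IR: "individually_rational t0 t1 v a p"
    using feasible by (auto simp: feasible_mechanism_def)
  have a: "a t \<in> stochastic_bundles n" if "t \<in> {t0..t1}" for t
    using mech that by (simp add: mechanism_def)
  define U where "U t = stoch_ext v (a t) t - p t" for t
  \<comment> \<open>Imitating type \<open>s\<close> gives type \<open>t\<close> the utility
    \<open>U s\<close> plus the change in value of the bundle meant for \<open>s\<close>.\<close>
  have increment: "U t - U s \<ge> stoch_ext v (a s) t - stoch_ext v (a s) s"
    if "s \<in> {t0..t1}" "t \<in> {t0..t1}" for s t
  proof -
    have "stoch_ext v (a t) t - p t \<ge> stoch_ext v (a s) t - p s"
      using IC that by (simp add: incentive_compatible_def)
    then show ?thesis by (simp add: U_def)
  qed
  have diff: "stoch_ext v (a s) t - stoch_ext v (a s) s = stoch_ext (\<lambda>b r. v b t - v b s) (a s) s"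
    if "s \<in> {t0..t1}" for s t
    by (simp add: stoch_ext_eq_sum[OF a[OF that]] sum_subtractf right_diff_distrib)
  obtain L where L: "L \<ge> 0" "\<And>b s t. b \<in> bundles n \<Longrightarrow> s \<in> {t0..t1} \<Longrightarrow> t \<in> {t0..t1} \<Longrightarrow>
      \<bar>v b s - v b t\<bar> \<le> L * \<bar>s - t\<bar>"
    using value_lipschitz by blast
  have abs_increment: "\<bar>stoch_ext v (a s) t - stoch_ext v (a s) s\<bar> \<le> L * \<bar>t - s\<bar>"
    if "s \<in> {t0..t1}" "t \<in> {t0..t1}" for s t
    unfolding diff[OF that(1)] by (rule abs_stoch_ext_le[OF a[OF that(1)]]) (rule L(2)[OF _ that(2,1)])
  \<comment> \<open>The increment bound, used in both directions, makes \<open>U\<close> Lipschitz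
    and hence continuous, as the integration by parts demands.\<close>
  have "L-lipschitz_on {t0..t1} U"
  proof (rule lipschitz_onI[OF _ L(1)])
    fix s t assume "s \<in> {t0..t1}" "t \<in> {t0..t1}"
    then show "dist (U s) (U t) \<le> L * dist s t"
      using increment[of s t] increment[of t s] abs_increment[of s t] abs_increment[of t s]
      by (auto simp: dist_real_def abs_minus_commute abs_le_iff)
  qed
  then have contU: "continuous_on {t0..t1} U"
    by (rule lipschitz_on_continuous_on)
  have contG: "continuous_on {t0..t1} survival"
    by (rule survival_continuous)
  have contv': "continuous_on {t0..t1} (v\<^sub>t b)" if "b \<in> bundles n" for b
    using value_deriv_continuous that by blast

  let ?r = "\<lambda>m t. min t1 (t + inverse (real (Suc m)))"
  have r: "?r m t \<in> {t0..t1}" if "t \<in> {t0..t1}" for m t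
    using that types by (auto simp: add_increasing2)
  have cont_r: "continuous_on {t0..t1} (\<lambda>t. g (?r m t))" if "continuous_on {t0..t1} g" for m and g :: "real \<Rightarrow> real"
    by (rule continuous_on_compose2[OF that]) (use r in \<open>auto intro!: continuous_intros\<close>)
  let ?S = "\<lambda>m t. (U (?r m t) - U t) * real (Suc m) * survival t"
  let ?q = "\<lambda>m b t. (v b (?r m t) - v b t) * real (Suc m)"
  have contq: "continuous_on {t0..t1} (?q m b)" if "b \<in> bundles n" for m b
    by (intro continuous_intros value_continuous[OF that] cont_r[OF value_continuous[OF that]])
  have boundq: "\<bar>?q m b t\<bar> \<le> L" if "b \<in> bundles n" "t \<in> {t0..t1}" for m b t
  proof -
    have "\<bar>v b (?r m t) - v b t\<bar> \<le> L * \<bar>?r m t - t\<bar>"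
      using L(2) that r by blast
    also have "\<dots> \<le> L * inverse (real (Suc m))"
      using that L(1) by (intro mult_left_mono) auto
    finally have "\<bar>v b (?r m t) - v b t\<bar> * real (Suc m) \<le> L * inverse (real (Suc m)) * real (Suc m)"
      by (rule mult_right_mono) simp
    also have "\<dots> = L" by simp
    finally show ?thesis by (simp only: abs_mult abs_of_nat)
  qed
  have "(\<lambda>m. LINT t:{t0..t1}|lborel. survival t * stoch_ext (?q m) (a t) t)
      \<longlonglongrightarrow> (LINT t:{t0..t1}|lborel. survival t * stoch_ext v\<^sub>t (a t) t)"
  proof (rule set_integral_Icc_LIMSEQ_bounded[where B = L])
    show "(\<lambda>t. survival t * stoch_ext (?q m) (a t) t) \<in> borel_measurable (restrict_space borel {t0..t1})" for m
      by (intro borel_measurable_times borel_measurable_continuous_on_restrict[OF contG]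
          stoch_ext_measurable[OF mech contq])
    show "(\<lambda>t. survival t * stoch_ext v\<^sub>t (a t) t) \<in> borel_measurable (restrict_space borel {t0..t1})"
      by (intro borel_measurable_times borel_measurable_continuous_on_restrict[OF contG]
          stoch_ext_measurable[OF mech contv'])
    show "\<bar>survival t * stoch_ext (?q m) (a t) t\<bar> \<le> L" if t: "t \<in> {t0..t1}" for m t
    proof -
      have "\<bar>stoch_ext (?q m) (a t) t\<bar> \<le> L"
        by (rule abs_stoch_ext_le[OF a[OF t]]) (rule boundq[OF _ t])
      moreover have "\<bar>survival t\<bar> \<le> 1"
        using survival_nonneg[of t] by (auto simp: abs_le_iff cdf_def)
      ultimately show ?thesis
        using mult_mono[of "\<bar>survival t\<bar>" 1 "\<bar>stoch_ext (?q m) (a t) t\<bar>" L] by (simp add: abs_mult)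
    qed
    show "(\<lambda>m. survival t * stoch_ext (?q m) (a t) t) \<longlonglongrightarrow> survival t * stoch_ext v\<^sub>t (a t) t"
      if t: "t0 \<le> t" "t < t1" for t
    proof -
      have at: "a t \<in> stochastic_bundles n" using a t by simp
      have "(\<lambda>m. ?q m b t) \<longlonglongrightarrow> v\<^sub>t b t" if "b \<in> bundles n" for b
        by (rule right_difference_quotient_LIMSEQ[OF value_DERIV[OF that]]) (use t in auto)
      then show ?thesis
        unfolding stoch_ext_eq_sum[OF at] by (intro tendsto_mult tendsto_sum tendsto_const)
    qed
  qed
  moreover have "(\<lambda>m. LINT t:{t0..t1}|lborel. ?S m t)
      \<longlonglongrightarrow> (LINT t:{t0..t1}|lborel. U t * f t) - U t0 * survival t0"
    by (rule integral_difference_quotients_by_parts[OF types contU density_continuous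
          survival_DERIV survival_highest])
  \<comment> \<open>The comparison holds pointwise at each fixed step size; afterwards both sides
    pass to the limit.\<close>
  moreover have "(LINT t:{t0..t1}|lborel. survival t * stoch_ext (?q m) (a t) t)
      \<le> (LINT t:{t0..t1}|lborel. ?S m t)" for m
  proof (rule set_integral_mono)
    show "set_integrable lborel {t0..t1} (\<lambda>t. survival t * stoch_ext (?q m) (a t) t)"
      by (rule set_integrable_stoch_ext[where g = "?q m", OF mech contq contG])
    show "set_integrable lborel {t0..t1} (?S m)"
      by (intro borel_integrable_atLeastAtMost' continuous_intros contG contU cont_r[OF contU])
    fix t assume t: "t \<in> {t0..t1}"
    have "stoch_ext (?q m) (a t) t = stoch_ext (\<lambda>b s. v b (?r m t) - v b t) (a t) t * real (Suc m)"
      by (simp add: stoch_ext_eq_sum[OF a[OF t]] sum_distrib_right mult.assoc del: of_nat_Suc)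
    also have "\<dots> \<le> (U (?r m t) - U t) * real (Suc m)"
      using increment[OF t r[OF t]] unfolding diff[OF t] by (intro mult_right_mono) auto
    finally show "survival t * stoch_ext (?q m) (a t) t \<le> ?S m t"
      using survival_nonneg[of t] by (subst mult.commute) (rule mult_right_mono)
  qed
  ultimately have "(LINT t:{t0..t1}|lborel. survival t * stoch_ext v\<^sub>t (a t) t)
      \<le> (LINT t:{t0..t1}|lborel. U t * f t) - U t0 * survival t0"
    by (auto intro: LIMSEQ_le)
  moreover have "U t0 \<ge> 0"
    using IR types by (simp add: individually_rational_def U_def)
  ultimately have surplus: "(LINT t:{t0..t1}|lborel. survival t * stoch_ext v\<^sub>t (a t) t)
      \<le> (LINT t:{t0..t1}|lborel. U t * f t)"
    by (simp add: survival_lowest)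

  have "revenue t0 t1 f p = (LINT t:{t0..t1}|lborel. f t * p t)"
    using mech by (intro revenue_eq_integral) (simp add: mechanism_def)
  also have "\<dots> = (LINT t:{t0..t1}|lborel.
      f t * stoch_ext \<phi> (a t) t + survival t * stoch_ext v\<^sub>t (a t) t - U t * f t)"
  proof (rule set_lebesgue_integral_cong)
    show "\<forall>t. t \<in> {t0..t1} \<longrightarrow> f t * p t =
        f t * stoch_ext \<phi> (a t) t + survival t * stoch_ext v\<^sub>t (a t) t - U t * f t"
    proof (intro allI impI)
      fix t assume t: "t \<in> {t0..t1}"
      have "f t * stoch_ext \<phi> (a t) t = (\<Sum>b\<in>bundles n. pmf (a t) b * (f t * \<phi> b t))"
        by (simp add: stoch_ext_eq_sum[OF a[OF t]] sum_distrib_left mult_ac)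
      also have "\<dots> = f t * stoch_ext v (a t) t - survival t * stoch_ext v\<^sub>t (a t) t"
        unfolding density_virtual_value[OF t]
        by (simp add: stoch_ext_eq_sum[OF a[OF t]] sum_distrib_left right_diff_distrib sum_subtractf mult_ac)
      finally show "f t * p t =
          f t * stoch_ext \<phi> (a t) t + survival t * stoch_ext v\<^sub>t (a t) t - U t * f t"
        by (simp add: U_def algebra_simps)
    qed
  qed simp
  also have "\<dots> = (LINT t:{t0..t1}|lborel. f t * stoch_ext \<phi> (a t) t)
      + (LINT t:{t0..t1}|lborel. survival t * stoch_ext v\<^sub>t (a t) t) - (LINT t:{t0..t1}|lborel. U t * f t)"
  proof -
    have "set_integrable lborel {t0..t1} (\<lambda>t. f t * stoch_ext \<phi> (a t) t)"
      by (rule set_integrable_stoch_ext[OF mech virtual_value_continuous density_continuous])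
    moreover have "set_integrable lborel {t0..t1} (\<lambda>t. survival t * stoch_ext v\<^sub>t (a t) t)"
      by (rule set_integrable_stoch_ext[OF mech contv' contG])
    moreover have "set_integrable lborel {t0..t1} (\<lambda>t. U t * f t)"
      by (intro borel_integrable_atLeastAtMost' continuous_intros contU density_continuous)
    ultimately show ?thesis
      by (simp only: set_integral_add set_integral_diff)
  qed
  finally show ?thesis using surplus by linarith
qed

end

subsection \<open>Single crossing\<close>

text \<open>A monotone sign attains its minimum over the interval at an endpoint, whichever its
  direction.\<close>

lemma single_crossing_on_Icc_sgn_ge:
  assumes "single_crossing_on {a..b} g" "t \<in> {a..b}"
  shows "min (sgn (g a)) (sgn (g b)) \<le> sgn (g t)"
proof -
  have "sgn (g a) \<le> sgn (g t) \<or> sgn (g b) \<le> sgn (g t)"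
    using assms(1) unfolding single_crossing_on_def monotonic_on_def
  proof
    assume "mono_on {a..b} (\<lambda>t. sgn (g t))"
    then show ?thesis using assms(2) by (auto dest: monotone_onD[where x = a and y = t])
  next
    assume "antimono_on {a..b} (\<lambda>t. sgn (g t))"
    then show ?thesis using assms(2) by (auto dest: monotone_onD[where x = t and y = b])
  qed
  then show ?thesis by (simp add: min_le_iff_disj)
qed

lemma single_crossing_on_Icc_pos:
  assumes "single_crossing_on {a..b} g" "t \<in> {a..b}" "g a > 0" "g b > 0"
  shows "g t > 0"
  using single_crossing_on_Icc_sgn_ge[OF assms(1,2)] assms(3,4) by (simp add: sgn_if split: if_splits)

lemma single_crossing_on_Icc_nonneg:
  assumes "single_crossing_on {a..b} g" "t \<in> {a..b}" "g a \<ge> 0" "g b \<ge> 0"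
  shows "g t \<ge> 0"
  using single_crossing_on_Icc_sgn_ge[OF assms(1,2)] assms(3,4) by (simp add: sgn_if split: if_splits)

text \<open>The signs at the two ends exclude a decreasing sign, so positivity persists
  upwards.\<close>

lemma single_crossing_on_Icc_stays_pos:
  assumes sc: "single_crossing_on {a..b} g" and ends: "g a < 0" "g b > 0"
    and st: "s \<in> {a..b}" "t \<in> {a..b}" "s \<le> t" "g s > 0"
  shows "g t > 0"
proof -
  have "a \<in> {a..b}" "b \<in> {a..b}" "a \<le> b" using st by auto
  then have "\<not> antimono_on {a..b} (\<lambda>t. sgn (g t))"
    using ends monotone_onD[of "{a..b}" "(\<le>)" "(\<ge>)" "\<lambda>t. sgn (g t)" a b] by auto
  then have "mono_on {a..b} (\<lambda>t. sgn (g t))"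
    using sc unfolding single_crossing_on_def monotonic_on_def by blast
  then have "sgn (g s) \<le> sgn (g t)"
    using st(1-3) by (rule monotone_onD)
  then show ?thesis using st(4) by (simp add: sgn_if split: if_splits)
qed

lemma single_crossing_on_scale:
  assumes "c > 0" "single_crossing_on S g"
  shows "single_crossing_on S (\<lambda>t. c * g t)"
  using assms by (simp add: single_crossing_on_def sgn_mult)

lemma single_crossing_on_cong:
  assumes "\<And>t. t \<in> S \<Longrightarrow> g t = h t" "single_crossing_on S g"
  shows "single_crossing_on S h"
  using assms by (auto simp: single_crossing_on_def monotonic_on_def monotone_on_def)

text \<open>Coefficients 1 and 1 suffice: the difference is 0 at \<open>a\<close> and positive at
  \<open>b\<close>, hence never negative in between.\<close>

lemma single_crossing_combinations_le:
  fixes u w :: "real \<Rightarrow> real"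
  assumes sc: "\<And>\<alpha> \<beta>. \<alpha> > 0 \<Longrightarrow> \<beta> > 0 \<Longrightarrow> single_crossing_on {a..b} (\<lambda>t. \<alpha> * w t - \<beta> * u t)"
    and ends: "u a = 1" "w a = 1" "u b < w b" and t: "t \<in> {a..b}"
  shows "u t \<le> w t"
  using single_crossing_on_Icc_nonneg[OF sc[of 1 1] t] ends by simp

text \<open>
  The mean of \<open>u\<close> and \<open>w\<close> has a zero. There \<open>u = w = 0\<close> is impossible, since a
  combination \<open>(1 + c) w - c u\<close> that is positive at both ends stays positive in between.
\<close>

lemma single_crossing_combinations_separate:
  fixes u w :: "real \<Rightarrow> real"
  assumes sc: "\<And>\<alpha> \<beta>. \<alpha> > 0 \<Longrightarrow> \<beta> > 0 \<Longrightarrow> single_crossing_on {a..b} (\<lambda>t. \<alpha> * w t - \<beta> * u t)"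
    and ends: "u a = 1" "w a = 1" "u b < w b" "w b < 0" and ab: "a < b"
    and cont: "continuous_on {a..b} u" "continuous_on {a..b} w"
  obtains t where "t \<in> {a..b}" "u t < 0" "0 < w t"
proof -
  \<comment> \<open>The sum is 2 at \<open>a\<close> and negative at \<open>b\<close>.\<close>
  have "\<exists>t\<ge>a. t \<le> b \<and> u t + w t = 0"
    by (rule IVT2') (use ends ab cont in \<open>auto intro!: continuous_intros\<close>)
  then obtain t where t: "t \<in> {a..b}" "u t + w t = 0" by auto
  have "u t \<noteq> w t"
  proof
    assume "u t = w t"
    with t have zero: "u t = 0" "w t = 0" by auto
    \<comment> \<open>This \<open>c\<close> gives the combination the value 1 at \<open>b\<close>,
      which it has at \<open>a\<close> for every \<open>c\<close>.\<close>
    define c where "c = (1 - w b) / (w b - u b)"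
    have c: "c > 0" using ends by (simp add: c_def)
    have "c * (w b - u b) = 1 - w b" using ends by (simp add: c_def)
    then have "(1 + c) * w b - c * u b > 0" by (simp add: algebra_simps)
    then have "(1 + c) * w t - c * u t > 0"
      using single_crossing_on_Icc_pos[OF sc[of "1 + c" c] t(1)] c ends by simp
    then show False using zero by simp
  qed
  moreover have "u t \<le> w t"
    by (rule single_crossing_combinations_le[OF sc ends(1-3) t(1)])
  ultimately show thesis using that[OF t(1)] t(2) by linarith
qed

context screening
begin

lemma virtual_value_highest: "\<phi> b t1 = v b t1"
  by (simp add: virtual_value_def survival_highest)

text \<open>If the value decreased, it would be positive at \<open>t0\<close>, being at least the
  value at \<open>t1\<close>, and its derivative there would be at most 0. The virtual value at
  \<open>t0\<close> would then be positive, against the standing assumption.\<close>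

lemma value_mono_of_monotonic:
  assumes b: "b \<in> bundles n" "b \<noteq> {}" and mono: "monotonic_on {t0..t1} (v b)"
  shows "mono_on {t0..t1} (v b)"
proof (rule ccontr)
  assume "\<not> ?thesis"
  then have anti: "v b t \<le> v b s" if "s \<in> {t0..t1}" "t \<in> {t0..t1}" "s \<le> t" for s t
    using mono that by (auto simp: monotonic_on_def monotone_on_def)
  have "(\<lambda>m. (v b (min t1 (t0 + inverse (real (Suc m)))) - v b t0) * real (Suc m)) \<longlonglongrightarrow> v\<^sub>t b t0"
    by (rule right_difference_quotient_LIMSEQ[OF value_DERIV[OF b(1)]]) (use types in auto)
  moreover have "(v b (min t1 (t0 + inverse (real (Suc m)))) - v b t0) * real (Suc m) \<le> 0" for m
    using types by (intro mult_nonpos_nonneg) (auto intro!: anti)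
  ultimately have "v\<^sub>t b t0 \<le> 0"
    by (intro LIMSEQ_le_const2) auto
  moreover have "v b t0 > 0"
    using anti[of t0 t1] value_highest b types by force
  moreover have "f t0 > 0"
    using density_pos types by simp
  ultimately have "\<phi> b t0 > 0"
    using divide_nonpos_pos[of "v\<^sub>t b t0" "f t0"] by (simp add: virtual_value_def survival_lowest)
  then show False using virtual_value_lowest b by force
qed

end

text \<open>Here \<open>j k\<close> is the good in place \<open>k\<close> of the ratio order. The
  hypotheses of the theorem are gathered for a single interpretation at the end.\<close>

locale additive_screening = screening +
  fixes j :: "nat \<Rightarrow> nat"
  assumes A1_virtual: "\<forall>b\<in>bundles n. \<forall>b'\<in>bundles n. single_crossing_on {t0..t1}
      (\<lambda>t. virtual_value t0 t1 f v b t - virtual_value t0 t1 f v b' t)"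
    and A1_value: "\<forall>b\<in>bundles n. \<forall>b'\<in>bundles n. monotonic_on {t0..t1} (\<lambda>t. v b t - v b' t)"
    and A2: "\<forall>a\<in>stochastic_bundles n. \<forall>a'\<in>stochastic_bundles n. single_crossing_on {t0..t1}
      (\<lambda>t. stoch_ext (virtual_value t0 t1 f v) a t - stoch_ext (virtual_value t0 t1 f v) a' t)"
    and additive: "\<forall>b\<in>bundles n. \<forall>t\<in>{t0..t1}. v b t = (\<Sum>i\<in>b. v {i} t)"
    and order: "bij_betw j {1..n} {1..n}"
    and ratios: "strict_mono_on {1..n}
      (\<lambda>k. virtual_value t0 t1 f v {j k} t1 / virtual_value t0 t1 f v {j k} t0)"
begin

section \<open>Virtual values of goods under additivity\<close>

lemma singleton_bundle [simp]: "{i} \<in> bundles n \<longleftrightarrow> i \<in> {1..n}"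
  by (auto simp: bundles_def)

lemma empty_bundle [simp]: "{} \<in> bundles n"
  by (simp add: bundles_def)

lemma order_good: "k \<in> {1..n} \<Longrightarrow> j k \<in> {1..n}"
  using order by (rule bij_betwE[THEN bspec])

text \<open>The virtual value is linear in the value and its derivative. The derivative within the
  interval is unique, also at the endpoints, because \<open>t0 < t1\<close>.\<close>

lemma virtual_value_additive:
  assumes b: "b \<in> bundles n" and t: "t \<in> {t0..t1}"
  shows "\<phi> b t = (\<Sum>i\<in>b. \<phi> {i} t)"
proof -
  have sub: "i \<in> {1..n}" if "i \<in> b" for i
    using b that by (auto simp: bundles_def)
  have "((\<lambda>t. \<Sum>i\<in>b. v {i} t) has_real_derivative (\<Sum>i\<in>b. v\<^sub>t {i} t)) (at t within {t0..t1})"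
    using t sub by (intro DERIV_sum value_DERIV) auto
  then have "(v b has_real_derivative (\<Sum>i\<in>b. v\<^sub>t {i} t)) (at t within {t0..t1})"
    by (rule has_field_derivative_transform_within[OF _ zero_less_one t]) (use additive b in auto)
  then have "v\<^sub>t b t = (\<Sum>i\<in>b. v\<^sub>t {i} t)"
    unfolding value_deriv_def using types t
    by (intro vector_derivative_within_closed_interval)
      (auto simp: has_real_derivative_iff_has_vector_derivative)
  moreover have "v b t = (\<Sum>i\<in>b. v {i} t)"
    using additive b t by blast
  ultimately show ?thesis
    by (simp add: virtual_value_def sum_subtractf sum_distrib_left)
qed

text \<open>A common index set makes two bundles comparable good by good.\<close>

lemma virtual_value_additive_indicator:
  assumes b: "b \<in> bundles n" and t: "t \<in> {t0..t1}"
  shows "\<phi> b t = (\<Sum>i\<in>{1..n}. if i \<in> b then \<phi> {i} t else 0)"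
proof -
  have "{1..n} \<inter> b = b" using b by (auto simp: bundles_def)
  then show ?thesis
    by (simp add: virtual_value_additive[OF b t] flip: sum.inter_restrict)
qed

lemma virtual_value_empty: "t \<in> {t0..t1} \<Longrightarrow> \<phi> {} t = 0"
  by (simp add: virtual_value_additive)

lemma virtual_value_good_lowest: "i \<in> {1..n} \<Longrightarrow> \<phi> {i} t0 < 0"
  using virtual_value_lowest by simp

lemma virtual_value_good_highest: "i \<in> {1..n} \<Longrightarrow> \<phi> {i} t1 > 0"
  using value_highest by (simp add: virtual_value_highest)

text \<open>Comparison with the empty bundle in (A1) makes the virtual value of a good itself
  single-crossing; it is negative at \<open>t0\<close> and positive at \<open>t1\<close>.\<close>

lemma virtual_value_good_stays_pos:
  assumes "i \<in> {1..n}" "s \<in> {t0..t1}" "t \<in> {t0..t1}" "s \<le> t" "\<phi> {i} s > 0"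
  shows "\<phi> {i} t > 0"
proof (rule single_crossing_on_Icc_stays_pos[where g = "\<phi> {i}" and s = s and t = t])
  have "single_crossing_on {t0..t1} (\<lambda>t. \<phi> {i} t - \<phi> {} t)"
    using A1_virtual assms(1) by simp
  then show "single_crossing_on {t0..t1} (\<phi> {i})"
    by (rule single_crossing_on_cong[rotated]) (simp add: virtual_value_empty)
qed (use assms virtual_value_good_lowest virtual_value_good_highest in auto)

lemma value_good_mono:
  assumes "i \<in> {1..n}"
  shows "mono_on {t0..t1} (v {i})"
proof (rule value_mono_of_monotonic)
  have "monotonic_on {t0..t1} (\<lambda>t. v {i} t - v {} t)"
    using A1_value assms by simp
  then show "monotonic_on {t0..t1} (v {i})"
    using value_empty by (auto simp: monotonic_on_def monotone_on_def)
qed (use assms in auto)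

text \<open>
  Mixing a good with the empty bundle scales its virtual value, so A2 covers every
  combination of two goods with coefficients of opposite signs.
\<close>

lemma single_crossing_goods:
  assumes i: "i \<in> {1..n}" "k \<in> {1..n}" and pos: "\<alpha> > 0" "\<beta> > 0"
  shows "single_crossing_on {t0..t1} (\<lambda>t. \<alpha> * \<phi> {i} t - \<beta> * \<phi> {k} t)"
proof -
  define lot where "lot p i = map_pmf (\<lambda>x. if x then {i :: nat} else {}) (bernoulli_pmf p)" for p i
  have lot: "lot p i \<in> stochastic_bundles n" if "i \<in> {1..n}" for p i
    using that by (auto simp: lot_def stochastic_bundles_def)
  have ext: "stoch_ext \<phi> (lot p i) t = p * \<phi> {i} t"
    if "p \<in> {0..1}" "t \<in> {t0..t1}" for p i t
    using that by (simp add: lot_def stoch_ext_def virtual_value_empty mult.commute)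
  \<comment> \<open>Dividing by \<open>\<alpha> + \<beta>\<close> turns both coefficients into
    probabilities, and multiplying back by a positive factor preserves signs.\<close>
  have "single_crossing_on {t0..t1} (\<lambda>t. (\<alpha> + \<beta>) *
      (stoch_ext \<phi> (lot (\<alpha> / (\<alpha> + \<beta>)) i) t - stoch_ext \<phi> (lot (\<beta> / (\<alpha> + \<beta>)) k) t))"
    using A2 lot i pos by (intro single_crossing_on_scale) auto
  then show ?thesis
    by (rule single_crossing_on_cong[rotated])
      (use pos in \<open>simp add: ext right_diff_distrib\<close>)
qed

section \<open>Normalised virtual values and their order\<close>

definition relative_virtual_value :: "nat \<Rightarrow> real \<Rightarrow> real" where
  "relative_virtual_value k t = \<phi> {j k} t / \<phi> {j k} t0"

text \<open>Division by the negative value at \<open>t0\<close> flips signs: a good is worth selling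
  where its normalised virtual value is negative.\<close>

lemma relative_virtual_value_sign:
  assumes "k \<in> {1..n}"
  shows "relative_virtual_value k t < 0 \<longleftrightarrow> \<phi> {j k} t > 0"
    "relative_virtual_value k t > 0 \<longleftrightarrow> \<phi> {j k} t < 0"
  using virtual_value_good_lowest[OF order_good[OF assms]]
  by (auto simp: relative_virtual_value_def divide_less_0_iff zero_less_divide_iff)

lemma relative_virtual_value_ends:
  assumes "k \<in> {1..n}"
  shows "relative_virtual_value k t0 = 1" "relative_virtual_value k t1 < 0"
  using assms virtual_value_good_lowest[OF order_good[OF assms]]
    virtual_value_good_highest[OF order_good[OF assms]]
  by (simp_all add: relative_virtual_value_def divide_pos_neg)

lemma relative_virtual_value_order:
  "i \<in> {1..n} \<Longrightarrow> k \<in> {1..n} \<Longrightarrow> i < k \<Longrightarrow> relative_virtual_value i t1 < relative_virtual_value k t1"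
  using ratios by (simp add: relative_virtual_value_def monotone_on_def)

text \<open>Both divisors are negative, so this is again a difference of two goods with positive
  coefficients, with the roles of \<open>i\<close> and \<open>k\<close> exchanged.\<close>

lemma relative_virtual_value_single_crossing:
  assumes "i \<in> {1..n}" "k \<in> {1..n}" "\<alpha> > 0" "\<beta> > 0"
  shows "single_crossing_on {t0..t1}
    (\<lambda>t. \<alpha> * relative_virtual_value k t - \<beta> * relative_virtual_value i t)"
proof -
  have neg: "\<phi> {j i} t0 < 0" "\<phi> {j k} t0 < 0"
    using assms order_good virtual_value_good_lowest by auto
  have "single_crossing_on {t0..t1}
      (\<lambda>t. - (\<beta> / \<phi> {j i} t0) * \<phi> {j i} t - - (\<alpha> / \<phi> {j k} t0) * \<phi> {j k} t)"
    using assms neg order_good by (intro single_crossing_goods) (auto simp: divide_pos_neg)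
  then show ?thesis
    by (rule single_crossing_on_cong[rotated]) (simp add: relative_virtual_value_def)
qed

lemma relative_virtual_value_continuous:
  "k \<in> {1..n} \<Longrightarrow> continuous_on {t0..t1} (relative_virtual_value k)"
  unfolding relative_virtual_value_def[abs_def]
  using virtual_value_good_lowest[OF order_good, of k] order_good[of k]
  by (intro continuous_intros virtual_value_continuous) auto

lemma relative_virtual_value_le:
  assumes "i \<in> {1..n}" "k \<in> {1..n}" "i \<le> k" "t \<in> {t0..t1}"
  shows "relative_virtual_value i t \<le> relative_virtual_value k t"
proof (cases "i = k")
  case False
  then show ?thesis
    using assms relative_virtual_value_ends relative_virtual_value_order
    by (intro single_crossing_combinations_le[OF relative_virtual_value_single_crossing]) auto
qed simp

text \<open>For \<open>k = 0\<close> and \<open>k = n\<close> the types \<open>t0\<close> and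
  \<open>t1\<close> serve. Otherwise a type separating the neighbours \<open>k\<close> and
  \<open>Suc k\<close> separates all goods, since the normalised virtual values are ordered at every
  type.\<close>

lemma separating_type:
  assumes "k \<le> n"
  obtains t where "t \<in> {t0..t1}" "\<And>i. i \<in> {1..n} \<Longrightarrow> i \<le> k \<Longrightarrow> \<phi> {j i} t > 0"
    "\<And>i. i \<in> {1..n} \<Longrightarrow> k < i \<Longrightarrow> \<phi> {j i} t < 0"
proof -
  consider "k = 0" | "k = n" | "k \<in> {1..n}" "Suc k \<in> {1..n}"
    using assms by force
  then show thesis
  proof cases
    case 1
    then show thesis
      using types order_good virtual_value_good_lowest by (intro that[of t0]) auto
  next
    case 2
    then show thesis
      using types order_good virtual_value_good_highest by (intro that[of t1]) auto
  next
    case 3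
    obtain t where t: "t \<in> {t0..t1}" "relative_virtual_value k t < 0" "0 < relative_virtual_value (Suc k) t"
      by (rule single_crossing_combinations_separate[OF relative_virtual_value_single_crossing[OF 3]
          relative_virtual_value_ends(1)[OF 3(1)] relative_virtual_value_ends(1)[OF 3(2)]
          relative_virtual_value_order[OF 3 lessI] relative_virtual_value_ends(2)[OF 3(2)] types
          relative_virtual_value_continuous[OF 3(1)] relative_virtual_value_continuous[OF 3(2)]])
    show thesis
    proof (rule that[OF t(1)])
      fix i assume i: "i \<in> {1..n}"
      show "\<phi> {j i} t > 0" if "i \<le> k"
        using relative_virtual_value_le[OF i 3(1) that t(1)] t(2) relative_virtual_value_sign(1)[OF i, of t]
        by linarith
      show "\<phi> {j i} t < 0" if "k < i"
        using relative_virtual_value_le[OF 3(2) i _ t(1)] t(3) that relative_virtual_value_sign(2)[OF i, of t]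
        by linarith
    qed
  qed
qed

subsection \<open>Posted prices and optimal menus\<close>

text \<open>The threshold is the greatest type with nonpositive virtual value. It exists by
  compactness, as \<open>t0\<close> is such a type. Hence the strict inequality: the threshold type
  itself is not served.\<close>

lemma threshold_exists:
  assumes i: "i \<in> {1..n}"
  shows "\<exists>\<tau>\<in>{t0..t1}. \<forall>t\<in>{t0..t1}. \<phi> {i} t > 0 \<longleftrightarrow> \<tau> < t"
proof -
  define S where "S = {t0..t1} \<inter> \<phi> {i} -` {..0}"
  have "closed S"
    unfolding S_def using i
    by (intro continuous_closed_preimage virtual_value_continuous) auto
  then have "compact ({t0..t1} \<inter> S)"
    by (intro compact_Int_closed) auto
  then have "compact S" by (simp add: S_def)
  moreover have "t0 \<in> S"
    using types virtual_value_good_lowest[OF i] by (simp add: S_def)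
  ultimately obtain \<tau> where \<tau>: "\<tau> \<in> S" "\<And>t. t \<in> S \<Longrightarrow> t \<le> \<tau>"
    using compact_attains_sup[of S] by blast
  have "\<phi> {i} t > 0 \<longleftrightarrow> \<tau> < t" if t: "t \<in> {t0..t1}" for t
  proof
    assume "\<phi> {i} t > 0"
    then show "\<tau> < t"
      using virtual_value_good_stays_pos[OF i t, of \<tau>] \<tau>(1) by (force simp: S_def)
  next
    assume "\<tau> < t"
    then show "\<phi> {i} t > 0" using \<tau>(2)[of t] t by (force simp: S_def)
  qed
  then show ?thesis using \<tau>(1) by (auto simp: S_def)
qed

definition threshold :: "nat \<Rightarrow> real" where
  "threshold i = (SOME \<tau>. \<tau> \<in> {t0..t1} \<and> (\<forall>t\<in>{t0..t1}. \<phi> {i} t > 0 \<longleftrightarrow> \<tau> < t))"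

lemma threshold:
  assumes "i \<in> {1..n}"
  shows "threshold i \<in> {t0..t1}"
    and "t \<in> {t0..t1} \<Longrightarrow> threshold i < t \<longleftrightarrow> \<phi> {i} t > 0"
  using someI_ex[OF threshold_exists[OF assms, unfolded Bex_def]] by (auto simp: threshold_def)

section \<open>The posted-price mechanism\<close>

definition sold :: "real \<Rightarrow> nat set" where
  "sold t = {i \<in> {1..n}. threshold i < t}"

definition price :: "real \<Rightarrow> real" where
  "price t = (\<Sum>i\<in>sold t. v {i} (threshold i))"

lemma sold_bundle [simp]: "sold t \<in> bundles n"
  by (auto simp: sold_def bundles_def)

text \<open>A fixed index set moves the dependence on \<open>t\<close> into the summands, ready for
  measurability and termwise integration.\<close>

lemma sum_sold: "(\<Sum>i\<in>sold t. g i) = (\<Sum>i\<in>{1..n}. if threshold i < t then g i else (0::real))"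
  unfolding sold_def by (rule sum.inter_filter) simp

lemma virtual_value_le_sold:
  assumes b: "b \<in> bundles n" and t: "t \<in> {t0..t1}"
  shows "\<phi> b t \<le> \<phi> (sold t) t"
  unfolding virtual_value_additive_indicator[OF b t] virtual_value_additive_indicator[OF sold_bundle t]
  using threshold(2)[OF _ t] by (intro sum_mono) (auto simp: sold_def not_less)

text \<open>When no virtual value is zero, each good on which \<open>b\<close> departs from
  \<open>sold t\<close> either forgoes a positive term or adds a negative one.\<close>

lemma virtual_value_less_sold:
  assumes b: "b \<in> bundles n" and t: "t \<in> {t0..t1}"
    and nonzero: "\<And>i. i \<in> {1..n} \<Longrightarrow> \<phi> {i} t \<noteq> 0" and ne: "b \<noteq> sold t"
  shows "\<phi> b t < \<phi> (sold t) t"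
  unfolding virtual_value_additive_indicator[OF b t] virtual_value_additive_indicator[OF sold_bundle t]
proof (rule sum_strict_mono_ex1)
  show "\<forall>i\<in>{1..n}. (if i \<in> b then \<phi> {i} t else 0) \<le> (if i \<in> sold t then \<phi> {i} t else 0)"
    using threshold(2)[OF _ t] by (auto simp: sold_def not_less)
  obtain i where "i \<in> b \<longleftrightarrow> i \<notin> sold t"
    using ne by blast
  moreover from this have "i \<in> {1..n}"
    using b by (auto simp: bundles_def sold_def)
  ultimately have i: "i \<in> {1..n}" "i \<in> b \<longleftrightarrow> i \<notin> sold t" by auto
  then have "(if i \<in> b then \<phi> {i} t else 0) < (if i \<in> sold t then \<phi> {i} t else 0)"
    using threshold(2)[OF i(1) t] nonzero[OF i(1)] by (auto simp: sold_def not_less)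
  then show "\<exists>i\<in>{1..n}. (if i \<in> b then \<phi> {i} t else 0) < (if i \<in> sold t then \<phi> {i} t else 0)"
    using i(1) by blast
qed simp

lemma stoch_virtual_value_le_sold:
  assumes a: "a \<in> stochastic_bundles n" and t: "t \<in> {t0..t1}"
  shows "stoch_ext \<phi> a t \<le> \<phi> (sold t) t"
proof -
  have "stoch_ext \<phi> a t \<le> (\<Sum>b\<in>bundles n. pmf a b * \<phi> (sold t) t)"
    unfolding stoch_ext_eq_sum[OF a]
    by (intro sum_mono mult_left_mono virtual_value_le_sold t) auto
  then show ?thesis
    by (simp add: sum_pmf_bundles[OF a] flip: sum_distrib_right)
qed

lemma posted_price_mechanism: "mechanism n t0 t1 (\<lambda>t. return_pmf (sold t)) price"
  unfolding mechanism_def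
proof (intro conjI ballI)
  fix b assume b: "b \<in> bundles n"
  \<comment> \<open>The event that exactly \<open>b\<close> is sold is a finite conjunction of
    comparisons with thresholds, hence Borel.\<close>
  have "(\<lambda>t. pmf (return_pmf (sold t)) b) =
      (\<lambda>t. if \<forall>i\<in>{1..n}. threshold i < t \<longleftrightarrow> i \<in> b then 1 else 0)"
    using b by (fastforce simp: sold_def bundles_def indicator_def)
  also have "\<dots> \<in> borel_measurable borel"
    by measurable
  finally show "(\<lambda>t. pmf (return_pmf (sold t)) b) \<in> borel_measurable (restrict_space borel {t0..t1})"
    by (rule measurable_restrict_space1)
next
  have "price \<in> borel_measurable borel"
    unfolding price_def[abs_def] sum_sold by measurable
  then show "price \<in> borel_measurable (restrict_space borel {t0..t1})"
    by (rule measurable_restrict_space1)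
qed (auto simp: stochastic_bundles_def)

text \<open>The surplus splits into one term per good, so incentive compatibility can be checked
  good by good.\<close>

lemma sold_surplus:
  assumes "s \<in> {t0..t1}" "t \<in> {t0..t1}"
  shows "v (sold s) t - price s = (\<Sum>i\<in>{1..n}. if threshold i < s then v {i} t - v {i} (threshold i) else 0)"
proof -
  have "v (sold s) t = (\<Sum>i\<in>sold s. v {i} t)"
    using additive assms(2) by simp
  then show ?thesis
    by (simp add: price_def sum_sold flip: sum_subtractf) (rule sum.cong, auto)
qed

text \<open>The value of a good increases with the type, so its term is nonnegative above the
  threshold and nonpositive below. The truthful choice collects exactly the terms above the
  threshold.\<close>

lemma posted_price_feasible: "feasible_mechanism n t0 t1 v (\<lambda>t. return_pmf (sold t)) price"
  unfolding feasible_mechanism_def incentive_compatible_def individually_rational_def stoch_ext_return_pmf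
proof (intro conjI ballI posted_price_mechanism)
  fix t assume t: "t \<in> {t0..t1}"
  have gain: "v {i} (threshold i) \<le> v {i} t" if "i \<in> {1..n}" "threshold i < t" for i
    using monotone_onD[OF value_good_mono[OF that(1)] threshold(1)[OF that(1)] t] that(2) by simp
  have loss: "v {i} t \<le> v {i} (threshold i)" if "i \<in> {1..n}" "\<not> threshold i < t" for i
    using monotone_onD[OF value_good_mono[OF that(1)] t threshold(1)[OF that(1)]] that(2) by simp
  show "v (sold t) t - price t \<ge> 0"
    unfolding sold_surplus[OF t t] using gain by (intro sum_nonneg) auto
  fix s assume s: "s \<in> {t0..t1}"
  show "v (sold t) t - price t \<ge> v (sold s) t - price s"
    unfolding sold_surplus[OF t t] sold_surplus[OF s t] using gain loss by (intro sum_mono) auto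
qed

section \<open>Revenue from posted prices\<close>

lemma integral_above_threshold:
  fixes g :: "real \<Rightarrow> real"
  assumes i: "i \<in> {1..n}"
    and F: "\<And>t. t \<in> {t0..t1} \<Longrightarrow> (F has_real_derivative g t) (at t within {t0..t1})"
    and g: "continuous_on {t0..t1} g"
  shows "set_integrable lborel {t0..t1} (\<lambda>t. if threshold i < t then g t else 0)"
    and "(LINT t:{t0..t1}|lborel. if threshold i < t then g t else 0) = F t1 - F (threshold i)"
proof -
  have \<tau>: "{threshold i..t1} \<subseteq> {t0..t1}" "threshold i \<le> t1"
    using threshold(1)[OF i] by auto
  obtain B where B: "B \<ge> 0" "\<And>t. t \<in> {t0..t1} \<Longrightarrow> \<bar>g t\<bar> \<le> B"
    using continuous_on_Icc_abs_bound[OF g] by blast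
  show "set_integrable lborel {t0..t1} (\<lambda>t. if threshold i < t then g t else 0)"
  proof (rule set_integrable_Icc_bounded)
    have "(\<lambda>t. indicator {threshold i<..} t * g t) \<in> borel_measurable (restrict_space borel {t0..t1})"
      by (intro borel_measurable_times borel_measurable_continuous_on_restrict[OF g]
          measurable_restrict_space1 borel_measurable_indicator) simp
    then show "(\<lambda>t. if threshold i < t then g t else 0) \<in> borel_measurable (restrict_space borel {t0..t1})"
      by (rule measurable_cong[THEN iffD1, rotated]) (simp add: indicator_def)
    show "\<bar>if threshold i < t then g t else 0\<bar> \<le> B" if "t \<in> {t0..t1}" for t
      using B that by auto
  qed
  \<comment> \<open>The two integrands differ at most at the threshold, which the strict inequality
    omits and the closed interval contains.\<close>
  have "(LINT t:{t0..t1}|lborel. if threshold i < t then g t else 0) =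
      (LINT t:{threshold i..t1}|lborel. g t)"
    unfolding set_lebesgue_integral_def
  proof (rule integral_cong_AE)
    have "set_integrable lborel {threshold i..t1} g"
      using g \<tau>(1) by (intro borel_integrable_atLeastAtMost') (rule continuous_on_subset)
    then show "(\<lambda>t. indicator {threshold i..t1} t *\<^sub>R g t) \<in> borel_measurable lborel"
      by (auto simp: set_integrable_def)
    show "(\<lambda>t. indicator {t0..t1} t *\<^sub>R (if threshold i < t then g t else 0)) \<in> borel_measurable lborel"
      using \<open>set_integrable lborel {t0..t1} (\<lambda>t. if threshold i < t then g t else 0)\<close>
      by (auto simp: set_integrable_def)
    show "AE t in lborel. indicator {t0..t1} t *\<^sub>R (if threshold i < t then g t else 0) =
        indicator {threshold i..t1} t *\<^sub>R g t"
      using AE_lborel_singleton[of "threshold i"]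
      by eventually_elim (use threshold(1)[OF i] in \<open>auto simp: indicator_def\<close>)
  qed
  also have "\<dots> = F t1 - F (threshold i)"
  proof (rule set_integral_FTC_Icc[OF \<tau>(2)])
    show "(F has_real_derivative g t) (at t within {threshold i..t1})" if "t \<in> {threshold i..t1}" for t
      by (rule DERIV_subset[OF F \<tau>(1)]) (use that \<tau>(1) in auto)
    show "continuous_on {threshold i..t1} g"
      by (rule continuous_on_subset[OF g \<tau>(1)])
  qed
  finally show "(LINT t:{t0..t1}|lborel. if threshold i < t then g t else 0) = F t1 - F (threshold i)" .
qed

text \<open>
  Both integrals equal \<open>v {i} (threshold i)\<close> times the mass of the types above the threshold,
  because \<open>- survival t * v {i} t\<close> is an antiderivative of \<open>f t * \<phi> {i} t\<close>.
\<close>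

lemma integral_price_eq_virtual_value:
  assumes i: "i \<in> {1..n}"
  shows "(LINT t:{t0..t1}|lborel. if threshold i < t then f t * v {i} (threshold i) else 0) =
    (LINT t:{t0..t1}|lborel. if threshold i < t then f t * \<phi> {i} t else 0)"
proof -
  have i': "{i} \<in> bundles n" using i by simp
  have "(LINT t:{t0..t1}|lborel. if threshold i < t then f t * \<phi> {i} t else 0) =
      - survival t1 * v {i} t1 - - survival (threshold i) * v {i} (threshold i)"
  proof (rule integral_above_threshold(2)[OF i])
    fix t assume t: "t \<in> {t0..t1}"
    show "((\<lambda>t. - survival t * v {i} t) has_real_derivative f t * \<phi> {i} t) (at t within {t0..t1})"
      using DERIV_mult[OF DERIV_minus[OF survival_DERIV[OF t]] value_DERIV[OF i' t]]
      by (simp add: density_virtual_value[OF t] algebra_simps)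
  qed (intro continuous_intros density_continuous virtual_value_continuous i')
  moreover have "(LINT t:{t0..t1}|lborel. if threshold i < t then f t * v {i} (threshold i) else 0) =
      - survival t1 * v {i} (threshold i) - - survival (threshold i) * v {i} (threshold i)"
  proof (rule integral_above_threshold(2)[OF i])
    fix t assume t: "t \<in> {t0..t1}"
    show "((\<lambda>t. - survival t * v {i} (threshold i)) has_real_derivative f t * v {i} (threshold i))
        (at t within {t0..t1})"
      using DERIV_cmult_right[OF DERIV_minus[OF survival_DERIV[OF t]]] by simp
  qed (intro continuous_intros density_continuous)
  ultimately show ?thesis by (simp add: survival_highest)
qed

lemma set_integral_sum_above_threshold:
  fixes g :: "nat \<Rightarrow> real \<Rightarrow> real"
  assumes g: "\<And>i. i \<in> {1..n} \<Longrightarrow> continuous_on {t0..t1} (g i)"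
  shows "(LINT t:{t0..t1}|lborel. \<Sum>i\<in>sold t. g i t) =
    (\<Sum>i\<in>{1..n}. LINT t:{t0..t1}|lborel. if threshold i < t then g i t else 0)"
proof -
  \<comment> \<open>Only integrability is wanted here; the running integral of \<open>g i\<close>
    serves as the antiderivative.\<close>
  have "set_integrable lborel {t0..t1} (\<lambda>t. if threshold i < t then g i t else 0)" if "i \<in> {1..n}" for i
    by (rule integral_above_threshold(1)[OF that integral_has_real_derivative[OF g[OF that]] g[OF that]])
  then show ?thesis
    unfolding sum_sold set_lebesgue_integral_def scaleR_sum_right
    by (intro Bochner_Integration.integral_sum) (simp add: set_integrable_def)
qed

lemma posted_price_revenue: "revenue t0 t1 f price = (LINT t:{t0..t1}|lborel. f t * \<phi> (sold t) t)"
proof -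
  have "revenue t0 t1 f price = (LINT t:{t0..t1}|lborel. f t * price t)"
    using posted_price_mechanism by (intro revenue_eq_integral) (simp add: mechanism_def)
  also have "\<dots> = (LINT t:{t0..t1}|lborel. \<Sum>i\<in>sold t. f t * v {i} (threshold i))"
    by (simp add: price_def sum_distrib_left)
  also have "\<dots> = (\<Sum>i\<in>{1..n}. LINT t:{t0..t1}|lborel.
      if threshold i < t then f t * v {i} (threshold i) else 0)"
    by (intro set_integral_sum_above_threshold continuous_on_mult_right density_continuous)
  also have "\<dots> = (\<Sum>i\<in>{1..n}. LINT t:{t0..t1}|lborel. if threshold i < t then f t * \<phi> {i} t else 0)"
    by (intro sum.cong refl integral_price_eq_virtual_value)
  also have "\<dots> = (LINT t:{t0..t1}|lborel. \<Sum>i\<in>sold t. f t * \<phi> {i} t)"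
    by (intro set_integral_sum_above_threshold[symmetric] continuous_on_mult density_continuous
        virtual_value_continuous) simp
  also have "\<dots> = (LINT t:{t0..t1}|lborel. f t * \<phi> (sold t) t)"
    by (rule set_lebesgue_integral_cong) (simp_all add: virtual_value_additive sum_distrib_left)
  finally show ?thesis .
qed

lemma set_integrable_sold: "set_integrable lborel {t0..t1} (\<lambda>t. f t * \<phi> (sold t) t)"
  using set_integrable_stoch_ext[where g = \<phi>, OF posted_price_mechanism virtual_value_continuous density_continuous]
  by simp

text \<open>Revenue is bounded by the virtual surplus and this by the integral of the pointwise
  maximum, which posted prices earn in full.\<close>

lemma posted_price_optimal: "optimal_mechanism n t0 t1 f v (\<lambda>t. return_pmf (sold t)) price"
  unfolding optimal_mechanism_def
proof (intro conjI allI impI posted_price_feasible)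
  fix a p assume feasible: "feasible_mechanism n t0 t1 v a p"
  then have mech: "mechanism n t0 t1 a p" by (simp add: feasible_mechanism_def)
  have "(LINT t:{t0..t1}|lborel. f t * stoch_ext \<phi> (a t) t) \<le> (LINT t:{t0..t1}|lborel. f t * \<phi> (sold t) t)"
  proof (rule set_integral_mono)
    show "set_integrable lborel {t0..t1} (\<lambda>t. f t * stoch_ext \<phi> (a t) t)"
      by (rule set_integrable_stoch_ext[OF mech virtual_value_continuous density_continuous])
    show "f t * stoch_ext \<phi> (a t) t \<le> f t * \<phi> (sold t) t" if t: "t \<in> {t0..t1}" for t
      using mech density_pos t
      by (intro mult_left_mono stoch_virtual_value_le_sold) (auto simp: mechanism_def less_imp_le)
  qed (rule set_integrable_sold)
  then show "revenue t0 t1 f p \<le> revenue t0 t1 f price"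
    using revenue_le_virtual_surplus[OF feasible] posted_price_revenue by simp
qed

text \<open>The gap to the pointwise maximum is nonnegative, and a positive integral would mean
  earning less than posted prices do. So the gap vanishes almost everywhere, and the positive
  density cancels.\<close>

lemma optimal_mechanism_AE:
  assumes opt: "optimal_mechanism n t0 t1 f v a p"
  shows "AE t in lborel. t \<in> {t0..t1} \<longrightarrow> stoch_ext \<phi> (a t) t = \<phi> (sold t) t"
proof -
  have feasible: "feasible_mechanism n t0 t1 v a p"
    and best: "revenue t0 t1 f price \<le> revenue t0 t1 f p"
    using opt posted_price_feasible by (auto simp: optimal_mechanism_def)
  have mech: "mechanism n t0 t1 a p" using feasible by (simp add: feasible_mechanism_def)
  let ?gap = "\<lambda>t. f t * \<phi> (sold t) t - f t * stoch_ext \<phi> (a t) t"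
  have int: "set_integrable lborel {t0..t1} (\<lambda>t. f t * stoch_ext \<phi> (a t) t)"
    by (rule set_integrable_stoch_ext[OF mech virtual_value_continuous density_continuous])
  have gap: "0 \<le> ?gap t" if t: "t \<in> {t0..t1}" for t
    using mech density_pos t
    by (auto simp: mechanism_def less_imp_le intro!: mult_left_mono stoch_virtual_value_le_sold)
  have int_gap: "set_integrable lborel {t0..t1} ?gap"
    by (rule set_integral_diff(1)[OF set_integrable_sold int])
  have "(LINT t:{t0..t1}|lborel. ?gap t) \<le> 0"
    using best revenue_le_virtual_surplus[OF feasible]
    by (simp add: posted_price_revenue set_integral_diff(2)[OF set_integrable_sold int])
  moreover have "(LINT t:{t0..t1}|lborel. ?gap t) \<ge> 0"
    unfolding set_lebesgue_integral_def by (rule integral_nonneg_AE) (use gap in \<open>auto simp: indicator_def\<close>)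
  ultimately have "(LINT t|lborel. indicator {t0..t1} t *\<^sub>R ?gap t) = 0"
    by (simp add: set_lebesgue_integral_def)
  then have "AE t in lborel. indicator {t0..t1} t *\<^sub>R ?gap t = 0"
    using int_gap gap
    by (subst (asm) integral_nonneg_eq_0_iff_AE) (auto simp: set_integrable_def indicator_def)
  then show ?thesis
  proof eventually_elim
    case (elim t)
    then show ?case using density_pos by force
  qed
qed

section \<open>The initial segments as the least optimal menu\<close>

definition initial_segments :: "nat set set" where
  "initial_segments = (\<lambda>k. j ` {1..k}) ` {..n}"

lemma order_image: "j ` {1..n} = {1..n}"
  using order by (rule bij_betw_imp_surj_on)

lemma initial_segment_bundle: "k \<le> n \<Longrightarrow> j ` {1..k} \<in> bundles n"
  using order_good by (auto simp: bundles_def)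

lemma sold_eq_image:
  assumes t: "t \<in> {t0..t1}"
  shows "sold t = j ` {k \<in> {1..n}. \<phi> {j k} t > 0}"
proof -
  have "sold t = {i \<in> {1..n}. \<phi> {i} t > 0}"
    using threshold(2)[OF _ t] by (auto simp: sold_def)
  also have "\<dots> = {i \<in> j ` {1..n}. \<phi> {i} t > 0}"
    by (simp only: order_image)
  finally show ?thesis by auto
qed

text \<open>By the order of the normalised virtual values, the positions of the goods sold are
  closed downwards; no sale is the segment of length 0.\<close>

lemma sold_in_initial_segments:
  assumes t: "t \<in> {t0..t1}"
  shows "sold t \<in> initial_segments"
proof -
  define K where "K = {k \<in> {1..n}. \<phi> {j k} t > 0}"
  have down: "i \<in> K" if "k \<in> K" "i \<in> {1..n}" "i \<le> k" for i k
  proof -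
    have k: "k \<in> {1..n}" "relative_virtual_value k t < 0"
      using that(1) relative_virtual_value_sign(1)[of k t] by (auto simp: K_def)
    then have "relative_virtual_value i t < 0"
      using relative_virtual_value_le[OF that(2) k(1) that(3) t] by linarith
    then show ?thesis
      using that(2) relative_virtual_value_sign(1)[OF that(2), of t] by (simp add: K_def)
  qed
  have "\<exists>k\<le>n. K = {1..k}"
  proof (cases "K = {}")
    case False
    have fin: "finite K" and sub: "K \<subseteq> {1..n}" by (auto simp: K_def)
    have max: "Max K \<in> K" "Max K \<le> n" using Max_in[OF fin False] sub by auto
    have "K = {1..Max K}"
    proof (intro equalityI subsetI)
      fix i assume i: "i \<in> {1..Max K}"
      show "i \<in> K" by (rule down[OF max(1)]) (use i max(2) in auto)
    next
      fix i assume "i \<in> K"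
      then show "i \<in> {1..Max K}" using Max_ge[OF fin] sub by auto
    qed
    with max(2) show ?thesis by (intro exI[of _ "Max K"] conjI)
  next
    case True
    then show ?thesis by (intro exI[of _ 0]) simp
  qed
  then obtain k where "k \<le> n" "K = {1..k}" by blast
  then show ?thesis
    unfolding sold_eq_image[OF t] initial_segments_def by (fold K_def) blast
qed

lemma initial_segments_optimal: "optimal_menu n t0 t1 f v initial_segments"
  unfolding optimal_menu_def
proof (intro conjI exI)
  show "initial_segments \<subseteq> bundles n"
    using initial_segment_bundle by (auto simp: initial_segments_def)
qed (use posted_price_optimal sold_in_initial_segments in auto)

text \<open>Equality almost everywhere says nothing about a single type, so the separating type is
  replaced by an open set of types with the same signs. There the segment is the only maximising
  bundle, and a deterministic optimal choice has to equal it at some type.\<close>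

lemma initial_segments_subset_optimal:
  assumes opt: "optimal_menu n t0 t1 f v B"
  shows "initial_segments \<subseteq> B"
proof -
  obtain a p where ap: "optimal_mechanism n t0 t1 f v a p"
    and range: "\<And>t. t \<in> {t0..t1} \<Longrightarrow> a t \<in> return_pmf ` B" and B: "B \<subseteq> bundles n"
    using opt by (auto simp: optimal_menu_def)
  show ?thesis
    unfolding initial_segments_def
  proof (rule image_subsetI)
    fix k assume "k \<in> {..n}"
    then have k: "k \<le> n" by simp
    \<comment> \<open>\<open>S\<close> fixes the sign of every virtual value: positive for the first
      \<open>k\<close> goods, negative for the others. Since \<open>n \<ge> 1\<close>, the
      intersection is over a nonempty index set and so stays within the type interval.\<close>
    define S where
      "S = (\<Inter>i\<in>{1..n}. {t0..t1} \<inter> \<phi> {j i} -` (if i \<le> k then {0<..} else {..<0}))"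
    have "openin (top_of_set {t0..t1}) S"
      unfolding S_def using goods order_good
      by (intro openin_INT2 continuous_openin_preimage_gen virtual_value_continuous) auto
    moreover obtain t where "t \<in> S"
    proof -
      obtain t where t: "t \<in> {t0..t1}" "\<And>i. i \<in> {1..n} \<Longrightarrow> i \<le> k \<Longrightarrow> \<phi> {j i} t > 0"
        "\<And>i. i \<in> {1..n} \<Longrightarrow> k < i \<Longrightarrow> \<phi> {j i} t < 0"
        using separating_type[OF k] by blast
      then have "t \<in> S" unfolding S_def by (intro INT_I) auto
      then show thesis by (rule that)
    qed
    ultimately obtain s where s: "s \<in> S" "stoch_ext \<phi> (a s) s = \<phi> (sold s) s"
      by (rule AE_lborel_openin_Icc_witness[OF optimal_mechanism_AE[OF ap] types])
    have sT: "s \<in> {t0..t1}"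
      using s(1) goods by (auto simp: S_def)
    have sign: "\<phi> {j i} s > 0 \<longleftrightarrow> i \<le> k" "\<phi> {j i} s \<noteq> 0" if "i \<in> {1..n}" for i
    proof -
      have "\<phi> {j i} s \<in> (if i \<le> k then {0<..} else {..<0})"
        using s(1) that unfolding S_def by blast
      then show "\<phi> {j i} s > 0 \<longleftrightarrow> i \<le> k" "\<phi> {j i} s \<noteq> 0"
        by (auto split: if_splits)
    qed
    have "{i \<in> {1..n}. \<phi> {j i} s > 0} = {1..k}"
      using k sign(1) by auto
    then have sold: "sold s = j ` {1..k}"
      using sold_eq_image[OF sT] by simp
    have nonzero: "\<phi> {i} s \<noteq> 0" if "i \<in> {1..n}" for i
    proof -
      have "i \<in> j ` {1..n}" using that by (simp only: order_image)
      then obtain l where "l \<in> {1..n}" "i = j l" by blast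
      then show ?thesis using sign(2) by simp
    qed
    obtain b where b: "b \<in> B" "a s = return_pmf b"
      using range[OF sT] by auto
    have "b = sold s"
    proof (rule ccontr)
      assume "b \<noteq> sold s"
      then have "\<phi> b s < \<phi> (sold s) s"
        using b(1) B by (intro virtual_value_less_sold sT nonzero) auto
      then show False using s(2) b(2) by simp
    qed
    then show "j ` {1..k} \<in> B" using b sold by simp
  qed
qed

text \<open>An optimal menu that is contained in all optimal menus is the only minimal one.\<close>

lemma minimal_optimal_menu_iff: "minimal_optimal_menu n t0 t1 f v B \<longleftrightarrow> B = initial_segments"
proof
  assume "minimal_optimal_menu n t0 t1 f v B"
  then have "initial_segments \<subseteq> B" "\<not> initial_segments \<subset> B"
    using initial_segments_optimal initial_segments_subset_optimal[of B]
    by (simp_all add: minimal_optimal_menu_def) blast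
  then show "B = initial_segments" by blast
next
  assume "B = initial_segments"
  moreover have "\<not> optimal_menu n t0 t1 f v B'" if "B' \<subset> initial_segments" for B'
    using initial_segments_subset_optimal[of B'] that by blast
  ultimately show "minimal_optimal_menu n t0 t1 f v B"
    using initial_segments_optimal by (simp add: minimal_optimal_menu_def)
qed

lemma nested_initial_segments: "nested_menu initial_segments"
  unfolding nested_menu_def chain_subset_def initial_segments_def
proof (intro ballI, elim imageE)
  fix A B k l assume AB: "A = j ` {1..k}" "B = j ` {1..l}"
  have "{1..k} \<subseteq> {1..l} \<or> {1..l} \<subseteq> {1..k}" by auto
  then show "A \<subseteq> B \<or> B \<subseteq> A"
    unfolding AB by (elim disjE) (simp_all only: image_mono simp_thms)
qed

text \<open>The segment of length \<open>n\<close> consists of all goods because \<open>j\<close>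
  permutes them; \<open>k = 0\<close> yields the empty bundle.\<close>

lemma initial_segments_eq:
  "initial_segments = insert {1..n} ((\<lambda>k. \<Union>i\<in>{1..k}. {j i}) ` {..<n})"
proof -
  have "{..n} = insert n {..<n}" by auto
  moreover have "(\<Union>i\<in>A. {j i}) = j ` A" for A by auto
  ultimately show ?thesis
    by (simp only: initial_segments_def image_insert order_image)
qed

end

theorem theorem5:
  fixes n :: nat and t0 t1 :: real and f :: "real \<Rightarrow> real"
    and v :: "nat set \<Rightarrow> real \<Rightarrow> real" and j :: "nat \<Rightarrow> nat"
  assumes env: "screening n t0 t1 f v"
    and A1_virtual: "\<forall>b\<in>bundles n. \<forall>b'\<in>bundles n. single_crossing_on {t0..t1}
      (\<lambda>t. virtual_value t0 t1 f v b t - virtual_value t0 t1 f v b' t)"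
    and A1_value: "\<forall>b\<in>bundles n. \<forall>b'\<in>bundles n. monotonic_on {t0..t1} (\<lambda>t. v b t - v b' t)"
    and A2: "\<forall>a\<in>stochastic_bundles n. \<forall>a'\<in>stochastic_bundles n. single_crossing_on {t0..t1}
      (\<lambda>t. stoch_ext (virtual_value t0 t1 f v) a t - stoch_ext (virtual_value t0 t1 f v) a' t)"
    and additive: "\<forall>b\<in>bundles n. \<forall>t\<in>{t0..t1}. v b t = (\<Sum>i\<in>b. v {i} t)"
    and order: "bij_betw j {1..n} {1..n}"
    and ratios: "strict_mono_on {1..n}
      (\<lambda>k. virtual_value t0 t1 f v {j k} t1 / virtual_value t0 t1 f v {j k} t0)"
  shows "(\<exists>!B. minimal_optimal_menu n t0 t1 f v B) \<and>
    (\<forall>B. minimal_optimal_menu n t0 t1 f v B \<longrightarrow>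
      nested_menu B \<and>
      B = insert {1..n} ((\<lambda>k. \<Union>i\<in>{1..k}. {j i}) ` {..<n}))"
proof -
  interpret additive_screening n t0 t1 f v j
    using env A1_virtual A1_value A2 additive order ratios
    by (simp add: additive_screening_def additive_screening_axioms_def)
  show ?thesis
    unfolding minimal_optimal_menu_iff initial_segments_eq[symmetric]
    using nested_initial_segments by blast
qed

end
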